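(* Let $k_1,k_2>0$ and $r\in[-1,1]\setminus\{0\}$, and let $X$ be a Pareto random variable with density on $(0,\infty)$ $$f_X(x)=\frac{|r|}{B(k_2,k_1)}\,\frac{x^{k_1r-1}}{(1+x^r)^{k_1+k_2}},$$ equivalently $X=(X_1/X_2)^{1/r}$ in distribution, where $X_1,X_2$ are independent and $X_j$ is Gamma distributed with shape $k_j$ and rate $1$. Then $X$ is a hyperbolically completely monotone random variable.
   Context: $B(a,b)=\int_0^1t^{a-1}(1-t)^{b-1}\,dt$ is the Beta function. A function $g:(0,\infty)\to[0,\infty)$ is hyperbolically completely monotone (HCM) if for each $u>0$ there is a nonnegative measure $K(\cdot\,;u)$ on $[0,\infty)$ with $g(uv)g(u/v)=\int_0^\infty e^{-\lambda u(v+v^{-1})}K(d\lambda;u)$ for all $v>0$. A random variable is HCM if it has a probability density on $(0,\infty)$ that is an HCM function. *)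

theory Defs
  imports "HOL-Probability.Probability"
begin

text \<open>
  A hyperbolically completely monotone function on \<open>(0, \<infinity>)\<close>; values of \<open>g\<close> at
  nonpositive arguments are irrelevant. The identity is stated in \<open>ennreal\<close>, so it
  includes finiteness of the integral on the right.
\<close>

definition hcm_function :: "(real \<Rightarrow> real) \<Rightarrow> bool" where
  "hcm_function g \<longleftrightarrow>
     (\<forall>x>0. g x \<ge> 0) \<and>
     (\<forall>u>0. \<exists>K :: real measure.
        sets K = sets (restrict_space borel {0..}) \<and>
        (\<forall>v>0. ennreal (g (u * v) * g (u / v)) =
          (\<integral>\<^sup>+ l. ennreal (exp (- l * u * (v + inverse v))) \<partial>K)))"

text \<open>
  Densities are determined only up to null sets, hence the existential quantifier.
\<close>

definition hcm_random_variable :: "'a measure \<Rightarrow> ('a \<Rightarrow> real) \<Rightarrow> bool" where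
  "hcm_random_variable M X \<longleftrightarrow>
     (\<exists>f. hcm_function f \<and>
          distributed M lborel X (\<lambda>x. ennreal (if x > 0 then f x else 0)))"

definition gamma_density :: "real \<Rightarrow> real \<Rightarrow> real" where
  "gamma_density k x = (if x > 0 then x powr (k - 1) * exp (- x) / Gamma k else 0)"

text \<open>
  \<open>Beta\<close> is the library function; its integral representation is \<open>has_integral_Beta_real\<close>.
\<close>

definition pareto_density :: "real \<Rightarrow> real \<Rightarrow> real \<Rightarrow> real \<Rightarrow> real" where
  "pareto_density k1 k2 r x =
     (if x > 0
      then \<bar>r\<bar> / Beta k2 k1 * (x powr (k1 * r - 1) / (1 + x powr r) powr (k1 + k2))
      else 0)"

end

theory Submission
  imports Defs
begin

text \<open>
  Write \<open>w = v + 1/v\<close> and \<open>h w = v powr r + v powr (-r)\<close>. Up to factors not depending on \<open>v\<close>, the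
  product of the Pareto density at \<open>u * v\<close> and \<open>u / v\<close> is \<open>(c + a * h w) powr (-k)\<close> with
  \<open>a, c > 0\<close> and \<open>k = k1 + k2\<close>. For \<open>0 < r < 1\<close> the Beta integral gives
  \<open>Beta r (1 - r) * h w = \<integral> cosh (r y) - 2 sinh y sinh (r y) / (w + 2 cosh y) dy\<close>. Cutting the
  integral off at \<open>\<plusminus>n\<close> leaves a constant minus a Laplace transform in \<open>w\<close>, so the binomial series
  of its power \<open>-k\<close> is a nonnegative combination of Laplace transforms of convolution powers.
  Letting \<open>n\<close> tend to infinity, Helly's selection theorem provides the representing measure.
  The case \<open>r = 1\<close> is a Gamma integral, and \<open>h\<close> is even in \<open>r\<close>.
\<close>

section \<open>Quotients of Gamma variables\<close>

text \<open>The substitution \<open>x = exp s\<close> is made on the compact intervals from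
  \<open>exp (- n)\<close> to \<open>exp n\<close>, and monotone convergence in \<open>n\<close>
  exhausts the half-line. Doing so for indicators identifies two measures, and the identity then
  passes to every measurable \<open>f\<close>.\<close>

lemma nn_integral_exp_substitution:
  fixes f :: "real \<Rightarrow> ennreal"
  assumes [measurable]: "f \<in> borel_measurable borel"
  shows "(\<integral>\<^sup>+x. f x * indicator {0<..} x \<partial>lborel) = (\<integral>\<^sup>+s. f (exp s) * ennreal (exp s) \<partial>lborel)"
proof -
  let ?M = "distr (density lborel (\<lambda>s. ennreal (exp s))) borel (exp :: real \<Rightarrow> real)"
  have eq: "density lborel (indicator {0<..}) = ?M"
  proof (rule measure_eqI)
    fix A :: "real set" assume "A \<in> sets (density lborel (indicator {0<..}))"
    then have [measurable]: "A \<in> sets borel" by simp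
    let ?F = "\<lambda>n x. ennreal (indicator A x) * indicator {exp (- real n)..exp (real n)} x"
    let ?G = "\<lambda>n s. ennreal (indicator A (exp s) * exp s) * indicator {- real n..real n} s"
    have FG: "(\<integral>\<^sup>+x. ?F n x \<partial>lborel) = (\<integral>\<^sup>+s. ?G n s \<partial>lborel)" for n
    proof -
      have "(\<integral>\<^sup>+x. ?F n x \<partial>lborel) = (\<integral>\<^sup>+x. ennreal (indicator A x * indicator {exp (- real n)..exp (real n)} x) \<partial>lborel)"
        by (intro nn_integral_cong) (auto simp: indicator_def)
      also have "\<dots> = (\<integral>\<^sup>+s. ennreal (indicator A (exp s) * exp s * indicator {- real n..real n} s) \<partial>lborel)"
        by (rule nn_integral_substitution)
           (auto intro!: derivative_eq_intros continuous_intros simp: set_borel_measurable_def)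
      also have "\<dots> = (\<integral>\<^sup>+s. ?G n s \<partial>lborel)"
        by (intro nn_integral_cong) (auto simp: indicator_def)
      finally show ?thesis .
    qed
    have "(\<lambda>n. \<integral>\<^sup>+x. ?F n x \<partial>lborel) \<longlonglongrightarrow> (\<integral>\<^sup>+x. ennreal (indicator A x) * indicator {0<..} x \<partial>lborel)"
    proof (rule nn_integral_LIMSEQ)
      show "incseq ?F"
        by (auto simp: incseq_def le_fun_def indicator_def intro: order_trans[rotated])
           (meson exp_le_cancel_iff neg_le_iff_le of_nat_le_iff order_trans)+
      fix x :: real
      show "(\<lambda>n. ?F n x) \<longlonglongrightarrow> ennreal (indicator A x) * indicator {0<..} x"
      proof (cases "x > 0")
        case True
        have "?F n x = ennreal (indicator A x) * indicator {0<..} x" if "nat \<lceil>\<bar>ln x\<bar>\<rceil> \<le> n" for n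
        proof -
          have "\<bar>ln x\<bar> \<le> real n" using that by linarith
          then have "exp (- real n) \<le> exp (ln x)" "exp (ln x) \<le> exp (real n)"
            unfolding exp_le_cancel_iff by linarith+
          then show ?thesis using True by (simp add: indicator_def)
        qed
        then show ?thesis by (intro tendsto_eventually eventually_sequentiallyI)
      next
        case False
        then have "x < exp a" for a by (smt (verit) exp_gt_zero)
        then have "\<not> exp a \<le> x" for a by (simp add: not_le)
        then show ?thesis using False by (simp add: indicator_def)
      qed
    qed auto
    moreover have "(\<lambda>n. \<integral>\<^sup>+s. ?G n s \<partial>lborel) \<longlonglongrightarrow> (\<integral>\<^sup>+s. ennreal (indicator A (exp s) * exp s) \<partial>lborel)"
    proof (rule nn_integral_LIMSEQ)
      show "incseq ?G"
        by (auto simp: incseq_def le_fun_def indicator_def)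
      fix s :: real
      have "?G n s = ennreal (indicator A (exp s) * exp s)" if "n \<ge> nat \<lceil>\<bar>s\<bar>\<rceil>" for n
      proof -
        have "\<bar>s\<bar> \<le> real n" using that by linarith
        then show ?thesis by (simp add: indicator_def abs_le_iff)
      qed
      then show "(\<lambda>n. ?G n s) \<longlonglongrightarrow> ennreal (indicator A (exp s) * exp s)"
        by (intro tendsto_eventually eventually_sequentiallyI)
    qed auto
    ultimately have "(\<integral>\<^sup>+x. ennreal (indicator A x) * indicator {0<..} x \<partial>lborel) =
        (\<integral>\<^sup>+s. ennreal (indicator A (exp s) * exp s) \<partial>lborel)"
      unfolding FG by (rule LIMSEQ_unique)
    moreover have "emeasure (density lborel (indicator {0<..})) A =
        (\<integral>\<^sup>+x. ennreal (indicator A x) * indicator {0<..} x \<partial>lborel)"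
      by (subst emeasure_density) (auto intro!: nn_integral_cong simp: indicator_def)
    moreover have "emeasure ?M A = (\<integral>\<^sup>+s. ennreal (indicator A (exp s) * exp s) \<partial>lborel)"
      using measurable_sets_borel[of exp borel A]
      by (subst emeasure_distr, simp, simp, subst emeasure_density)
         (auto intro!: nn_integral_cong simp: indicator_def)
    ultimately show "emeasure (density lborel (indicator {0<..})) A = emeasure ?M A"
      by simp
  qed simp
  have "(\<integral>\<^sup>+x. f x * indicator {0<..} x \<partial>lborel) = (\<integral>\<^sup>+x. f x \<partial>density lborel (indicator {0<..}))"
    by (subst nn_integral_density) (auto simp: mult.commute)
  also have "\<dots> = (\<integral>\<^sup>+s. f (exp s) \<partial>density lborel (\<lambda>s. ennreal (exp s)))"
    unfolding eq by (subst nn_integral_distr) auto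
  also have "\<dots> = (\<integral>\<^sup>+s. f (exp s) * ennreal (exp s) \<partial>lborel)"
    by (subst nn_integral_density) (auto simp: mult.commute)
  finally show ?thesis .
qed

text \<open>Euler's integral in the logarithmic coordinate \<open>t = exp s\<close>; translation by
  \<open>ln b\<close> introduces the rate \<open>b\<close>.\<close>

lemma nn_integral_exp_Gamma:
  fixes k b :: real
  assumes "k > 0" "b > 0"
  shows "(\<integral>\<^sup>+s. ennreal (exp (k * s - b * exp s)) \<partial>lborel) = ennreal (Gamma k / b powr k)"
proof -
  have "ennreal (Gamma k) = (\<integral>\<^sup>+t. ennreal (t powr (k - 1) / exp t) * indicator {0<..} t \<partial>lborel)"
    unfolding Gamma_conv_nn_integral_real[OF \<open>k > 0\<close>]
    by (intro nn_integral_cong) (auto simp: indicator_def)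
  also have "\<dots> = (\<integral>\<^sup>+s. ennreal (exp s powr (k - 1) / exp (exp s)) * ennreal (exp s) \<partial>lborel)"
    by (rule nn_integral_exp_substitution) simp
  also have "\<dots> = (\<integral>\<^sup>+s. ennreal (exp (k * s - exp s)) \<partial>lborel)"
    by (intro nn_integral_cong)
       (simp add: ennreal_mult[symmetric] powr_def exp_diff left_diff_distrib)
  also have "\<dots> = ennreal \<bar>1\<bar> * (\<integral>\<^sup>+s. ennreal (exp (k * (ln b + 1 * s) - exp (ln b + 1 * s))) \<partial>lborel)"
    by (rule nn_integral_real_affine) auto
  also have "\<dots> = (\<integral>\<^sup>+s. ennreal (b powr k) * ennreal (exp (k * s - b * exp s)) \<partial>lborel)"
    using \<open>b > 0\<close>
    by (simp add: ennreal_mult[symmetric] powr_def exp_add[symmetric] distrib_left)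
       (simp add: exp_add algebra_simps)
  also have "\<dots> = ennreal (b powr k) * (\<integral>\<^sup>+s. ennreal (exp (k * s - b * exp s)) \<partial>lborel)"
    by (rule nn_integral_cmult) simp
  finally have *: "ennreal (Gamma k) = ennreal (b powr k) * (\<integral>\<^sup>+s. ennreal (exp (k * s - b * exp s)) \<partial>lborel)" .
  have "ennreal (Gamma k / b powr k) = ennreal (Gamma k) * ennreal (inverse (b powr k))"
    using assms by (simp add: ennreal_mult[symmetric] divide_inverse)
  also have "\<dots> = ennreal (b powr k * inverse (b powr k)) * (\<integral>\<^sup>+s. ennreal (exp (k * s - b * exp s)) \<partial>lborel)"
    unfolding * using assms by (subst ennreal_mult) (auto simp: ac_simps)
  finally show ?thesis using assms by simp
qed

lemma gamma_density_measurable [measurable]: "gamma_density k \<in> borel_measurable borel"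
  unfolding gamma_density_def [abs_def] by measurable

lemma pareto_density_measurable [measurable]: "pareto_density k1 k2 r \<in> borel_measurable borel"
  unfolding pareto_density_def [abs_def] by measurable

lemma nn_integral_gamma_density:
  fixes f :: "real \<Rightarrow> ennreal"
  assumes "k > 0" and [measurable]: "f \<in> borel_measurable borel"
  shows "(\<integral>\<^sup>+x. f x * ennreal (gamma_density k x) \<partial>lborel) =
    (\<integral>\<^sup>+a. f (exp a) * ennreal (exp (k * a - exp a) / Gamma k) \<partial>lborel)"
proof -
  have "(\<integral>\<^sup>+x. f x * ennreal (gamma_density k x) \<partial>lborel) =
      (\<integral>\<^sup>+x. f x * ennreal (gamma_density k x) * indicator {0<..} x \<partial>lborel)"
    by (intro nn_integral_cong) (auto simp: gamma_density_def indicator_def)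
  also have "\<dots> = (\<integral>\<^sup>+a. f (exp a) * ennreal (gamma_density k (exp a)) * ennreal (exp a) \<partial>lborel)"
    by (rule nn_integral_exp_substitution) simp
  also have "\<dots> = (\<integral>\<^sup>+a. f (exp a) * ennreal (exp (k * a - exp a) / Gamma k) \<partial>lborel)"
    using \<open>k > 0\<close>
    by (intro nn_integral_cong, subst mult.assoc, subst ennreal_mult''[symmetric])
       (simp_all add: gamma_density_def powr_def exp_diff exp_minus left_diff_distrib field_simps)
  finally show ?thesis .
qed

lemma nn_integral_pareto_density:
  fixes f :: "real \<Rightarrow> ennreal"
  assumes [measurable]: "f \<in> borel_measurable borel"
  shows "(\<integral>\<^sup>+x. f x * ennreal (pareto_density k1 k2 r x) \<partial>lborel) =
    (\<integral>\<^sup>+s. f (exp s) * ennreal (\<bar>r\<bar> / Beta k2 k1 * (exp (k1 * r * s) / (1 + exp (r * s)) powr (k1 + k2))) \<partial>lborel)"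
proof -
  have "(\<integral>\<^sup>+x. f x * ennreal (pareto_density k1 k2 r x) \<partial>lborel) =
      (\<integral>\<^sup>+x. f x * ennreal (pareto_density k1 k2 r x) * indicator {0<..} x \<partial>lborel)"
    by (intro nn_integral_cong) (auto simp: pareto_density_def indicator_def)
  also have "\<dots> = (\<integral>\<^sup>+s. f (exp s) * ennreal (pareto_density k1 k2 r (exp s)) * ennreal (exp s) \<partial>lborel)"
    by (rule nn_integral_exp_substitution) simp
  also have "\<dots> = (\<integral>\<^sup>+s. f (exp s) * ennreal (\<bar>r\<bar> / Beta k2 k1 * (exp (k1 * r * s) / (1 + exp (r * s)) powr (k1 + k2))) \<partial>lborel)"
    by (intro nn_integral_cong)
       (simp add: pareto_density_def mult.assoc ennreal_mult''[symmetric] powr_def [of "exp _"] exp_diff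
          left_diff_distrib)
  finally show ?thesis .
qed

text \<open>In logarithmic coordinates the quotient becomes a difference:
  \<open>(x / y) powr (1 / r)\<close> is \<open>exp ((a - b) / r)\<close>. Once \<open>s\<close>
  replaces this exponent, integrating out \<open>b\<close> leaves a Gamma integral of shape
  \<open>k1 + k2\<close>.\<close>

lemma nn_integral_gamma_quotient:
  fixes f :: "real \<Rightarrow> ennreal"
  assumes k: "k1 > 0" "k2 > 0" and r: "r \<noteq> 0" and [measurable]: "f \<in> borel_measurable borel"
  shows "(\<integral>\<^sup>+y. (\<integral>\<^sup>+x. f ((x / y) powr (1 / r)) * ennreal (gamma_density k1 x) \<partial>lborel) *
        ennreal (gamma_density k2 y) \<partial>lborel) =
    (\<integral>\<^sup>+t. f t * ennreal (pareto_density k1 k2 r t) \<partial>lborel)"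
proof -
  have G: "Gamma k1 > 0" "Gamma k2 > 0" "Gamma (k1 + k2) > 0" using k by auto
  have "(\<integral>\<^sup>+y. (\<integral>\<^sup>+x. f ((x / y) powr (1 / r)) * ennreal (gamma_density k1 x) \<partial>lborel) *
        ennreal (gamma_density k2 y) \<partial>lborel) =
      (\<integral>\<^sup>+b. (\<integral>\<^sup>+x. f ((x / exp b) powr (1 / r)) * ennreal (gamma_density k1 x) \<partial>lborel) *
        ennreal (exp (k2 * b - exp b) / Gamma k2) \<partial>lborel)"
    by (rule nn_integral_gamma_density[OF k(2)]) simp
  also have "\<dots> = (\<integral>\<^sup>+b. (\<integral>\<^sup>+a. f (exp ((a - b) / r)) * ennreal (exp (k1 * a - exp a) / Gamma k1) \<partial>lborel) *
        ennreal (exp (k2 * b - exp b) / Gamma k2) \<partial>lborel)"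
    by (subst nn_integral_gamma_density[OF k(1)]) (auto simp: exp_diff[symmetric] powr_def)
  \<comment> \<open>The change of variable \<open>a = b + r * s\<close> at fixed \<open>b\<close>;
    its Jacobian \<open>\<bar>r\<bar>\<close> covers negative \<open>r\<close> as well.\<close>
  also have "\<dots> = (\<integral>\<^sup>+b. (ennreal \<bar>r\<bar> * (\<integral>\<^sup>+s. f (exp ((b + r * s - b) / r)) *
          ennreal (exp (k1 * (b + r * s) - exp (b + r * s)) / Gamma k1) \<partial>lborel)) *
        ennreal (exp (k2 * b - exp b) / Gamma k2) \<partial>lborel)"
    by (rule nn_integral_cong, rule arg_cong2[where f = "(*)"], rule nn_integral_real_affine)
       (use r in auto)
  also have "\<dots> = (\<integral>\<^sup>+b. \<integral>\<^sup>+s. f (exp s) * ennreal (\<bar>r\<bar> * (exp (k1 * r * s) / (Gamma k1 * Gamma k2))) *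
       ennreal (exp ((k1 + k2) * b - (1 + exp (r * s)) * exp b)) \<partial>lborel \<partial>lborel)"
  proof (rule nn_integral_cong)
    fix b :: real
    have "(ennreal \<bar>r\<bar> * (\<integral>\<^sup>+s. f (exp ((b + r * s - b) / r)) *
          ennreal (exp (k1 * (b + r * s) - exp (b + r * s)) / Gamma k1) \<partial>lborel)) *
        ennreal (exp (k2 * b - exp b) / Gamma k2) =
      (\<integral>\<^sup>+s. ennreal (exp (k2 * b - exp b) / Gamma k2) * (ennreal \<bar>r\<bar> * (f (exp ((b + r * s - b) / r)) *
          ennreal (exp (k1 * (b + r * s) - exp (b + r * s)) / Gamma k1))) \<partial>lborel)"
      by (subst nn_integral_cmult, simp, subst nn_integral_cmult, simp, simp add: mult.commute)
    also have "\<dots> = (\<integral>\<^sup>+s. f (exp s) * ennreal (\<bar>r\<bar> * (exp (k1 * r * s) / (Gamma k1 * Gamma k2))) *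
       ennreal (exp ((k1 + k2) * b - (1 + exp (r * s)) * exp b)) \<partial>lborel)"
    proof (rule nn_integral_cong)
      fix s :: real
      have "exp (k2 * b - exp b) / Gamma k2 * \<bar>r\<bar> * (exp (k1 * (b + r * s) - exp (b + r * s)) / Gamma k1) =
        \<bar>r\<bar> * (exp (k1 * r * s) / (Gamma k1 * Gamma k2)) * exp ((k1 + k2) * b - (1 + exp (r * s)) * exp b)"
        by (simp add: exp_add exp_diff algebra_simps)
      moreover have "ennreal x * (ennreal y * (F * ennreal z)) = F * ennreal (x * y * z)"
          if "x \<ge> 0" "y \<ge> 0" "z \<ge> 0" for x y z and F :: ennreal
        using that by (simp add: ennreal_mult ac_simps)
      moreover have "F * ennreal y * ennreal z = F * ennreal (y * z)"
          if "y \<ge> 0" "z \<ge> 0" for y z and F :: ennreal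
        using that by (simp add: ennreal_mult ac_simps)
      ultimately show "ennreal (exp (k2 * b - exp b) / Gamma k2) * (ennreal \<bar>r\<bar> * (f (exp ((b + r * s - b) / r)) *
          ennreal (exp (k1 * (b + r * s) - exp (b + r * s)) / Gamma k1))) =
        f (exp s) * ennreal (\<bar>r\<bar> * (exp (k1 * r * s) / (Gamma k1 * Gamma k2))) *
        ennreal (exp ((k1 + k2) * b - (1 + exp (r * s)) * exp b))"
        using G r by simp
    qed
    finally show "(ennreal \<bar>r\<bar> * (\<integral>\<^sup>+s. f (exp ((b + r * s - b) / r)) *
          ennreal (exp (k1 * (b + r * s) - exp (b + r * s)) / Gamma k1) \<partial>lborel)) *
        ennreal (exp (k2 * b - exp b) / Gamma k2) =
      (\<integral>\<^sup>+s. f (exp s) * ennreal (\<bar>r\<bar> * (exp (k1 * r * s) / (Gamma k1 * Gamma k2))) *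
       ennreal (exp ((k1 + k2) * b - (1 + exp (r * s)) * exp b)) \<partial>lborel)" .
  qed
  also have "\<dots> = (\<integral>\<^sup>+s. \<integral>\<^sup>+b. f (exp s) * ennreal (\<bar>r\<bar> * (exp (k1 * r * s) / (Gamma k1 * Gamma k2))) *
       ennreal (exp ((k1 + k2) * b - (1 + exp (r * s)) * exp b)) \<partial>lborel \<partial>lborel)"
    by (rule lborel_pair.Fubini') simp
  also have "\<dots> = (\<integral>\<^sup>+s. f (exp s) * ennreal (\<bar>r\<bar> / Beta k2 k1 *
        (exp (k1 * r * s) / (1 + exp (r * s)) powr (k1 + k2))) \<partial>lborel)"
  proof (rule nn_integral_cong)
    fix s :: real
    \<comment> \<open>The integral over \<open>b\<close> has rate \<open>1 + exp (r * s)\<close>,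
      which becomes the denominator of the Pareto density; the three Gamma values combine to
      \<open>1 / Beta k2 k1\<close>.\<close>
    have "(\<integral>\<^sup>+b. f (exp s) * ennreal (\<bar>r\<bar> * (exp (k1 * r * s) / (Gamma k1 * Gamma k2))) *
       ennreal (exp ((k1 + k2) * b - (1 + exp (r * s)) * exp b)) \<partial>lborel) =
      f (exp s) * ennreal (\<bar>r\<bar> * (exp (k1 * r * s) / (Gamma k1 * Gamma k2))) *
        ennreal (Gamma (k1 + k2) / (1 + exp (r * s)) powr (k1 + k2))"
      using k by (subst nn_integral_cmult) (simp_all add: nn_integral_exp_Gamma add_pos_pos)
    also have "\<dots> = f (exp s) * ennreal (\<bar>r\<bar> * (exp (k1 * r * s) / (Gamma k1 * Gamma k2)) *
        (Gamma (k1 + k2) / (1 + exp (r * s)) powr (k1 + k2)))"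
      using G by (simp add: ennreal_mult[symmetric] mult.assoc)
    also have "\<bar>r\<bar> * (exp (k1 * r * s) / (Gamma k1 * Gamma k2)) *
        (Gamma (k1 + k2) / (1 + exp (r * s)) powr (k1 + k2)) =
      \<bar>r\<bar> / Beta k2 k1 * (exp (k1 * r * s) / (1 + exp (r * s)) powr (k1 + k2))"
      using G by (simp add: Beta_def field_simps add.commute)
    finally show "(\<integral>\<^sup>+b. f (exp s) * ennreal (\<bar>r\<bar> * (exp (k1 * r * s) / (Gamma k1 * Gamma k2))) *
       ennreal (exp ((k1 + k2) * b - (1 + exp (r * s)) * exp b)) \<partial>lborel) =
      f (exp s) * ennreal (\<bar>r\<bar> / Beta k2 k1 * (exp (k1 * r * s) / (1 + exp (r * s)) powr (k1 + k2)))" .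
  qed
  also have "\<dots> = (\<integral>\<^sup>+t. f t * ennreal (pareto_density k1 k2 r t) \<partial>lborel)"
    by (rule nn_integral_pareto_density[symmetric]) simp
  finally show ?thesis .
qed

lemma nn_integral_gamma_density_1: "k > 0 \<Longrightarrow> (\<integral>\<^sup>+x. ennreal (gamma_density k x) \<partial>lborel) = 1"
  using nn_integral_gamma_density[of k "\<lambda>_. 1"] nn_integral_exp_Gamma[of k 1]
  by (simp add: divide_ennreal[symmetric] nn_integral_divide)
     (auto simp: divide_ennreal Gamma_eq_zero_iff)

text \<open>The constant test function \<open>1\<close> in the quotient identity reduces the claim
  to the total masses of the two Gamma laws.\<close>

lemma nn_integral_pareto_density_1:
  assumes "k1 > 0" "k2 > 0" "r \<noteq> 0"
  shows "(\<integral>\<^sup>+x. ennreal (pareto_density k1 k2 r x) \<partial>lborel) = 1"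
  using nn_integral_gamma_quotient[OF assms, of "\<lambda>_. 1"] assms
  by (simp add: nn_integral_gamma_density_1)

text \<open>Independence makes the joint law a product, so the iterated integral of an indicator is
  the one computed in \<open>nn_integral_gamma_quotient\<close>.\<close>

lemma distr_gamma_quotient:
  fixes N :: "'b measure"
  assumes k: "k1 > 0" "k2 > 0" and r: "r \<noteq> 0" and "prob_space N"
    and ind: "prob_space.indep_var N borel X1 borel X2"
    and X1: "distributed N lborel X1 (gamma_density k1)"
    and X2: "distributed N lborel X2 (gamma_density k2)"
  shows "distr N borel (\<lambda>\<omega>. (X1 \<omega> / X2 \<omega>) powr (1 / r)) = density lborel (pareto_density k1 k2 r)"
proof (rule measure_eqI)
  interpret prob_space N by fact
  have [measurable]: "X1 \<in> borel_measurable N" "X2 \<in> borel_measurable N"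
    using ind by (auto dest: indep_var_rv1 indep_var_rv2)
  have d: "distr N borel X1 = density lborel (gamma_density k1)"
      "distr N borel X2 = density lborel (gamma_density k2)"
    using distributed_distr_eq_density[OF X1] distributed_distr_eq_density[OF X2]
    by (metis distr_cong sets_lborel)+
  interpret D1: prob_space "distr N borel X1" by (rule prob_space_distr) simp
  interpret D2: prob_space "distr N borel X2" by (rule prob_space_distr) simp
  interpret D: pair_sigma_finite "distr N borel X1" "distr N borel X2" ..
  fix A assume "A \<in> sets (distr N borel (\<lambda>\<omega>. (X1 \<omega> / X2 \<omega>) powr (1 / r)))"
  then have [measurable]: "A \<in> sets borel" by simp
  have "emeasure (distr N borel (\<lambda>\<omega>. (X1 \<omega> / X2 \<omega>) powr (1 / r))) A =
      (\<integral>\<^sup>+t. indicator A t \<partial>distr N borel (\<lambda>\<omega>. (X1 \<omega> / X2 \<omega>) powr (1 / r)))"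
    by simp
  also have "\<dots> = (\<integral>\<^sup>+\<omega>. indicator A ((X1 \<omega> / X2 \<omega>) powr (1 / r)) \<partial>N)"
    by (subst nn_integral_distr) auto
  also have "\<dots> = (\<integral>\<^sup>+p. indicator A ((fst p / snd p) powr (1 / r))
      \<partial>distr N (borel \<Otimes>\<^sub>M borel) (\<lambda>\<omega>. (X1 \<omega>, X2 \<omega>)))"
    by (subst nn_integral_distr) auto
  also have "distr N (borel \<Otimes>\<^sub>M borel) (\<lambda>\<omega>. (X1 \<omega>, X2 \<omega>)) = distr N borel X1 \<Otimes>\<^sub>M distr N borel X2"
    using ind by (simp add: indep_var_distribution_eq)
  also have "(\<integral>\<^sup>+p. indicator A ((fst p / snd p) powr (1 / r)) \<partial>(distr N borel X1 \<Otimes>\<^sub>M distr N borel X2)) =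
      (\<integral>\<^sup>+y. \<integral>\<^sup>+x. indicator A ((x / y) powr (1 / r)) \<partial>distr N borel X1 \<partial>distr N borel X2)"
    by (subst D.nn_integral_snd[symmetric]) auto
  also have "\<dots> = (\<integral>\<^sup>+y. (\<integral>\<^sup>+x. indicator A ((x / y) powr (1 / r)) * ennreal (gamma_density k1 x) \<partial>lborel) *
        ennreal (gamma_density k2 y) \<partial>lborel)"
    unfolding d by (subst nn_integral_density, simp, simp)+ (simp add: mult.commute)
  also have "\<dots> = (\<integral>\<^sup>+t. indicator A t * ennreal (pareto_density k1 k2 r t) \<partial>lborel)"
    by (rule nn_integral_gamma_quotient) (use k r in auto)
  also have "\<dots> = emeasure (density lborel (pareto_density k1 k2 r)) A"
    by (subst emeasure_density) (auto simp: mult.commute)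
  finally show "emeasure (distr N borel (\<lambda>\<omega>. (X1 \<omega> / X2 \<omega>) powr (1 / r))) A =
    emeasure (density lborel (pareto_density k1 k2 r)) A" .
qed simp

text \<open>The form used for representing measures: \<open>k = 1\<close> exhibits
  \<open>1 / b\<close> as a Laplace transform, general \<open>k\<close> a negative power of
  \<open>b\<close>.\<close>

lemma nn_integral_powr_exp:
  fixes k b :: real
  assumes "k > 0" "b > 0"
  shows "(\<integral>\<^sup>+x. ennreal (x powr (k - 1) * exp (- (b * x))) * indicator {0<..} x \<partial>lborel) = ennreal (Gamma k / b powr k)"
proof -
  have "(\<integral>\<^sup>+x. ennreal (x powr (k - 1) * exp (- (b * x))) * indicator {0<..} x \<partial>lborel) =
      (\<integral>\<^sup>+s. ennreal (exp s powr (k - 1) * exp (- (b * exp s))) * ennreal (exp s) \<partial>lborel)"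
    by (rule nn_integral_exp_substitution) simp
  also have "\<dots> = (\<integral>\<^sup>+s. ennreal (exp (k * s - b * exp s)) \<partial>lborel)"
    by (intro nn_integral_cong)
       (simp add: ennreal_mult[symmetric] powr_def exp_diff exp_minus left_diff_distrib field_simps)
  finally show ?thesis using nn_integral_exp_Gamma[OF assms] by simp
qed

section \<open>Laplace transforms of measures on the half-line\<close>

text \<open>The measure lives on all of \<open>borel\<close> and is carried by the half-line, so
  that convolution and weak convergence on the real line apply to it. The case \<open>z = 0\<close>
  says that the total mass is finite and equal to \<open>ennreal (\<phi> 0)\<close>.\<close>

definition laplace_transform_of :: "real measure \<Rightarrow> (real \<Rightarrow> real) \<Rightarrow> bool" where
  "laplace_transform_of P \<phi> \<longleftrightarrow> sets P = sets borel \<and> (AE x in P. 0 \<le> x) \<and>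
     (\<forall>z\<ge>0. (\<integral>\<^sup>+x. ennreal (exp (- (x * z))) \<partial>P) = ennreal (\<phi> z))"

lemma laplace_transform_of_cong:
  assumes "laplace_transform_of P \<phi>" "\<And>z. z \<ge> 0 \<Longrightarrow> \<phi> z = \<psi> z"
  shows "laplace_transform_of P \<psi>"
  using assms by (simp add: laplace_transform_of_def)

lemma laplace_transform_of_scale:
  assumes P: "laplace_transform_of P \<phi>" and "c \<ge> 0"
  shows "laplace_transform_of (density P (\<lambda>_. ennreal c)) (\<lambda>z. c * \<phi> z)"
proof -
  have [measurable_cong, simp]: "sets P = sets borel" using P by (simp add: laplace_transform_of_def)
  show ?thesis using P \<open>c \<ge> 0\<close>
    by (auto simp: laplace_transform_of_def AE_density nn_integral_density nn_integral_cmult ennreal_mult')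
qed

lemma laplace_transform_of_return: "laplace_transform_of (return borel 0) (\<lambda>_. 1)"
  by (simp add: laplace_transform_of_def AE_return nn_integral_return)

text \<open>The exponential of a sum factors. The sign conditions turn the product of the
  \<open>ennreal\<close> values into the value of the product, since \<open>ennreal\<close> sends
  negative numbers to \<open>0\<close>.\<close>

lemma laplace_transform_of_convolution:
  assumes P: "laplace_transform_of P \<phi>" "finite_measure P"
    and Q: "laplace_transform_of Q \<psi>" "finite_measure Q"
    and nonneg: "\<And>z. z \<ge> 0 \<Longrightarrow> \<phi> z \<ge> 0" "\<And>z. z \<ge> 0 \<Longrightarrow> \<psi> z \<ge> 0"
  shows "laplace_transform_of (P \<star> Q) (\<lambda>z. \<phi> z * \<psi> z)"
proof -
  have S[measurable_cong, simp]: "sets P = sets borel" "sets Q = sets borel"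
    using P Q by (auto simp: laplace_transform_of_def)
  have AE: "AE x in P. 0 \<le> x" "AE x in Q. 0 \<le> x"
    using P Q by (auto simp: laplace_transform_of_def)
  \<comment> \<open>A sum of two nonnegative numbers is never negative, so the convolution gives no
    mass to the negative half-line.\<close>
  have "(\<integral>\<^sup>+x. indicator {..<0} x \<partial>(P \<star> Q)) = (\<integral>\<^sup>+x. \<integral>\<^sup>+y. indicator {..<0} (x + y) \<partial>Q \<partial>P)"
    by (rule nn_integral_convolution) (use P Q in auto)
  also have "\<dots> = (\<integral>\<^sup>+x. \<integral>\<^sup>+y. 0 \<partial>Q \<partial>P)"
  proof (rule nn_integral_cong_AE, use AE(1) in eventually_elim)
    fix x :: real assume "0 \<le> x"
    then show "(\<integral>\<^sup>+y. indicator {..<0} (x + y) \<partial>Q) = (\<integral>\<^sup>+y. 0 \<partial>Q)"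
      by (intro nn_integral_cong_AE eventually_mono[OF AE(2)]) auto
  qed
  finally have "AE x in P \<star> Q. indicator {..<0} x = (0 :: ennreal)"
    using nn_integral_0_iff_AE[of "indicator {..<0}" "P \<star> Q"] by simp
  then have "AE x in P \<star> Q. 0 \<le> x"
    by eventually_elim (auto simp: indicator_def split: if_splits)
  moreover have "(\<integral>\<^sup>+x. ennreal (exp (- (x * z))) \<partial>(P \<star> Q)) = ennreal (\<phi> z * \<psi> z)" if "z \<ge> 0" for z
  proof -
    have "(\<integral>\<^sup>+x. ennreal (exp (- (x * z))) \<partial>(P \<star> Q)) = (\<integral>\<^sup>+x. \<integral>\<^sup>+y. ennreal (exp (- ((x + y) * z))) \<partial>Q \<partial>P)"
      by (rule nn_integral_convolution) (use P Q in auto)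
    also have "\<dots> = (\<integral>\<^sup>+x. ennreal (exp (- (x * z))) * (\<integral>\<^sup>+y. ennreal (exp (- (y * z))) \<partial>Q) \<partial>P)"
      by (subst nn_integral_cmult[symmetric])
         (auto intro!: nn_integral_cong simp: ennreal_mult[symmetric] exp_add[symmetric] algebra_simps)
    also have "\<dots> = ennreal (\<phi> z) * ennreal (\<psi> z)"
      using P Q that by (subst nn_integral_multc) (auto simp: laplace_transform_of_def)
    finally show ?thesis using nonneg that by (simp add: ennreal_mult)
  qed
  ultimately show ?thesis by (simp add: laplace_transform_of_def)
qed

lemma laplace_transform_of_subprob:
  assumes P: "laplace_transform_of P \<phi>" and "\<phi> 0 \<le> 1"
  shows "subprob_space P"
proof (rule subprob_spaceI)
  have "emeasure P (space P) = ennreal (\<phi> 0)"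
    using P unfolding laplace_transform_of_def by (auto dest!: spec[of _ 0])
  then show "emeasure P (space P) \<le> 1" using \<open>\<phi> 0 \<le> 1\<close> by simp
  have "space P = UNIV" using P sets_eq_imp_space_eq[of P borel] by (auto simp: laplace_transform_of_def)
  then show "space P \<noteq> {}" by simp
qed

text \<open>Iterated convolution, starting from the point mass at \<open>0\<close>. The bound on
  \<open>\<phi> 0\<close> keeps every power a subprobability measure.\<close>

lemma laplace_transform_of_power:
  assumes P: "laplace_transform_of P \<phi>" and nonneg: "\<And>z. z \<ge> 0 \<Longrightarrow> \<phi> z \<ge> 0" and le1: "\<phi> 0 \<le> 1"
  shows "\<exists>Q. laplace_transform_of Q (\<lambda>z. \<phi> z ^ n)"
proof (induction n)
  case 0
  then show ?case using laplace_transform_of_return by auto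
next
  case (Suc n)
  then obtain Q where Q: "laplace_transform_of Q (\<lambda>z. \<phi> z ^ n)" by blast
  have "subprob_space P" "subprob_space Q"
    using laplace_transform_of_subprob[OF P le1] laplace_transform_of_subprob[OF Q]
      power_le_one[OF nonneg le1] by auto
  then have "laplace_transform_of (P \<star> Q) (\<lambda>z. \<phi> z * \<phi> z ^ n)"
    using P Q nonneg by (intro laplace_transform_of_convolution) (auto simp: subprob_space_def)
  then show ?case by auto
qed

text \<open>The representing measure is the mixture of the convolution powers \<open>Q n\<close>
  with weights \<open>b n\<close>, obtained by binding the weighted counting measure
  \<open>?D\<close> to the kernel \<open>Q\<close>. The total weight may be infinite.\<close>

lemma laplace_transform_of_power_series:
  assumes P: "laplace_transform_of P \<phi>" and nonneg: "\<And>z. z \<ge> 0 \<Longrightarrow> \<phi> z \<ge> 0" and le1: "\<phi> 0 \<le> 1"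
    and b: "\<And>n. b n \<ge> 0" and sums: "\<And>z. z \<ge> 0 \<Longrightarrow> (\<lambda>n. b n * \<phi> z ^ n) sums \<psi> z"
  shows "\<exists>K. laplace_transform_of K \<psi>"
proof -
  obtain Q where Q: "\<And>n. laplace_transform_of (Q n) (\<lambda>z. \<phi> z ^ n)"
    using laplace_transform_of_power[OF P nonneg le1] by metis
  have sub: "subprob_space (Q n)" for n
    using laplace_transform_of_subprob[OF Q] power_le_one[OF nonneg le1] by auto
  let ?D = "density (count_space UNIV) (\<lambda>n. ennreal (b n))"
  have sets_Q: "sets (Q n) = sets borel" for n using Q by (simp add: laplace_transform_of_def)
  then have "Q n \<in> space (subprob_algebra borel)" for n
    using sub by (simp add: space_subprob_algebra)
  then have Q_measurable [measurable]: "Q \<in> measurable ?D (subprob_algebra borel)" by simp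
  have "laplace_transform_of (?D \<bind> Q) \<psi>"
    unfolding laplace_transform_of_def
  proof (intro conjI allI impI)
    show "sets (?D \<bind> Q) = sets borel"
      by (rule sets_bind) (simp_all add: sets_Q)
    show "AE x in ?D \<bind> Q. 0 \<le> x"
      using Q by (subst AE_bind[OF Q_measurable]) (auto simp: laplace_transform_of_def)
    fix z :: real assume z: "z \<ge> 0"
    have "(\<integral>\<^sup>+x. ennreal (exp (- (x * z))) \<partial>(?D \<bind> Q)) = (\<integral>\<^sup>+n. \<integral>\<^sup>+x. ennreal (exp (- (x * z))) \<partial>Q n \<partial>?D)"
      by (rule nn_integral_bind[OF _ Q_measurable]) simp
    also have "\<dots> = (\<integral>\<^sup>+n. ennreal (\<phi> z ^ n) \<partial>?D)"
      using Q z by (simp add: laplace_transform_of_def)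
    also have "\<dots> = (\<Sum>n. ennreal (b n * \<phi> z ^ n))"
      using b nonneg z by (simp add: nn_integral_density nn_integral_count_space_nat ennreal_mult)
    also have "\<dots> = ennreal (\<psi> z)"
      using b nonneg z by (intro suminf_ennreal_eq sums) auto
    finally show "(\<integral>\<^sup>+x. ennreal (exp (- (x * z))) \<partial>(?D \<bind> Q)) = ennreal (\<psi> z)" .
  qed
  then show ?thesis by blast
qed

text \<open>The binomial series of \<open>(1 - x) powr (- k)\<close> has the nonnegative
  coefficients \<open>pochhammer k n / fact n\<close>; the strict bound on \<open>\<phi>\<close>
  gives convergence even at \<open>z = 0\<close>.\<close>

lemma laplace_transform_of_one_minus_powr:
  assumes P: "laplace_transform_of P \<phi>" and "k > 0"
    and range: "\<And>z. z \<ge> 0 \<Longrightarrow> 0 \<le> \<phi> z \<and> \<phi> z < 1"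
  shows "\<exists>K. laplace_transform_of K (\<lambda>z. (1 - \<phi> z) powr (- k))"
proof (rule laplace_transform_of_power_series[OF P])
  show "\<phi> z \<ge> 0" if "z \<ge> 0" for z using range[OF that] by simp
  show "\<phi> 0 \<le> 1" using range[of 0] by simp
  show "pochhammer k n / fact n \<ge> 0" for n
    using \<open>k > 0\<close> by (intro divide_nonneg_nonneg less_imp_le[OF pochhammer_pos]) auto
  fix z :: real assume "z \<ge> 0"
  then have "(\<lambda>n. (- k gchoose n) * (- \<phi> z) ^ n) sums (1 + - \<phi> z) powr - k"
    using range by (intro gen_binomial_real) auto
  also have "(\<lambda>n. (- k gchoose n) * (- \<phi> z) ^ n) = (\<lambda>n. pochhammer k n / fact n * \<phi> z ^ n)"
  proof
    fix n
    have "(- 1) ^ n * (- \<phi> z) ^ n = \<phi> z ^ n" by (simp flip: power_mult_distrib)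
    then show "(- k gchoose n) * (- \<phi> z) ^ n = pochhammer k n / fact n * \<phi> z ^ n"
      by (simp add: gbinomial_pochhammer)
  qed
  finally show "(\<lambda>n. pochhammer k n / fact n * \<phi> z ^ n) sums (1 - \<phi> z) powr - k" by simp
qed

text \<open>A continuity theorem. After normalisation to probability measures, right continuity of
  \<open>\<psi>\<close> at \<open>0\<close> yields tightness, a subsequence converges weakly, and
  bounded continuous test functions identify the transform and the support of the limit.\<close>

lemma laplace_transform_of_limit:
  assumes K: "\<And>n. laplace_transform_of (K n) (\<phi> n)"
    and pos: "\<And>n z. z \<ge> 0 \<Longrightarrow> \<phi> n z > 0" and pos': "\<psi> 0 > 0"
    and lim: "\<And>z. z \<ge> 0 \<Longrightarrow> (\<lambda>n. \<phi> n z) \<longlonglongrightarrow> \<psi> z"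
    and cont: "(\<psi> \<longlongrightarrow> \<psi> 0) (at_right 0)"
  shows "\<exists>K. laplace_transform_of K \<psi>"
proof -
  define \<mu> where "\<mu> n = density (K n) (\<lambda>_. ennreal (1 / \<phi> n 0))" for n
  have \<mu>: "laplace_transform_of (\<mu> n) (\<lambda>z. 1 / \<phi> n 0 * \<phi> n z)" for n
    unfolding \<mu>_def using pos[of 0 n] by (intro laplace_transform_of_scale K) auto
  have S[measurable_cong, simp]: "sets (\<mu> n) = sets borel" for n
    using \<mu> by (simp add: laplace_transform_of_def)
  have sp[simp]: "space (\<mu> n) = UNIV" for n using sets_eq_imp_space_eq[OF S] by simp
  have AE_\<mu>: "AE x in \<mu> n. 0 \<le> x" for n
    using \<mu> by (simp add: laplace_transform_of_def)
  have int_\<mu>: "(\<integral>\<^sup>+x. ennreal (exp (- (x * z))) \<partial>\<mu> n) = ennreal (1 / \<phi> n 0 * \<phi> n z)" if "z \<ge> 0" for n z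
    using \<mu> that by (simp add: laplace_transform_of_def)
  have rd: "real_distribution (\<mu> n)" for n
  proof -
    have "emeasure (\<mu> n) (space (\<mu> n)) = 1" using int_\<mu>[of 0 n] pos[of 0 n] by simp
    then interpret prob_space "\<mu> n" by (rule prob_spaceI)
    show ?thesis by standard auto
  qed
  interpret \<mu>: real_distribution "\<mu> n" for n by (rule rd)
  define L where "L n z = \<phi> n z / \<phi> n 0" for n z
  \<comment> \<open>The cut-off \<open>max 0 x\<close> makes the test function bounded and
    continuous on the whole line; almost everywhere for \<open>\<mu> n\<close> it agrees with the
    exponential in the transform.\<close>
  define f where "f z x = exp (- (max 0 x * z))" for z x :: real
  have [measurable]: "f z \<in> borel_measurable borel" for z unfolding f_def by measurable
  have f_bound: "0 \<le> f z x" "f z x \<le> 1" if "z \<ge> 0" for z x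
    using that by (auto simp: f_def)
  have integrable_f: "integrable M (f z)" if "z \<ge> 0" "real_distribution M" for M z
  proof -
    interpret M: real_distribution M by fact
    show ?thesis by (rule M.integrable_const_bound[where B = 1]) (use f_bound[OF that(1)] in auto)
  qed
  have int_f: "(\<integral>x. f z x \<partial>\<mu> n) = L n z" if "z \<ge> 0" for n z
  proof -
    have "(\<integral>\<^sup>+x. ennreal (f z x) \<partial>\<mu> n) = (\<integral>\<^sup>+x. ennreal (exp (- (x * z))) \<partial>\<mu> n)"
      by (rule nn_integral_cong_AE, use AE_\<mu>[of n] in eventually_elim) (simp add: f_def)
    then have "(\<integral>\<^sup>+x. ennreal (f z x) \<partial>\<mu> n) = ennreal (L n z)"
      using int_\<mu>[OF that, of n] by (simp add: L_def)
    then show ?thesis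
      using f_bound[OF that] pos[OF that, of n] pos[of 0 n]
      by (intro integral_eq_nn_integral[THEN trans]) (auto simp: L_def)
  qed
  have limL: "(\<lambda>n. L n z) \<longlonglongrightarrow> \<psi> z / \<psi> 0" if "z \<ge> 0" for z
    unfolding L_def using that pos' by (intro tendsto_divide lim) auto
  \<comment> \<open>A Markov-type bound: beyond \<open>1 / z\<close> the function
    \<open>1 - f z x\<close> is at least \<open>1 - exp (- 1)\<close>, hence at least one half,
    which explains the factor \<open>2\<close>.\<close>
  have tail: "1 - cdf (\<mu> n) (1 / z) \<le> 2 * (1 - L n z)" if "z > 0" for n z
  proof -
    have "1 - cdf (\<mu> n) (1 / z) = measure (\<mu> n) (UNIV - {..1 / z})"
      by (subst \<mu>.prob_compl[of "{..1 / z}" n, simplified]) (auto simp: cdf_def)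
    also have "\<dots> = (\<integral>x. indicator (UNIV - {..1 / z}) x \<partial>\<mu> n)" by simp
    also have "\<dots> \<le> (\<integral>x. 2 * (1 - f z x) \<partial>\<mu> n)"
    proof (rule integral_mono)
      show "indicator (UNIV - {..1 / z}) x \<le> 2 * (1 - f z x)" for x
      proof (cases "x > 1 / z")
        case True
        moreover from this that have "x > 0" by (smt (verit) divide_pos_pos)
        ultimately have "x * z \<ge> 1" "x > 0" using that by (auto simp: field_simps)
        then have "f z x \<le> exp (- 1)" by (simp add: f_def)
        also have "exp (- 1) \<le> (1 / 2 :: real)"
          using exp_ge_add_one_self[of 1] by (simp add: exp_minus field_simps)
        finally show ?thesis by (simp add: indicator_def)
      qed (use f_bound[of z x] that in \<open>auto simp: indicator_def\<close>)
    next
      show "integrable (\<mu> n) (indicat_real (UNIV - {..1 / z}))"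
        by (rule \<mu>.integrable_const_bound[where B = 1]) auto
      show "integrable (\<mu> n) (\<lambda>x. 2 * (1 - f z x))"
        using integrable_f[OF _ rd, of z n] that by simp
    qed
    also have "\<dots> = 2 * (1 - L n z)"
      using that integrable_f[OF _ rd, of z n] \<mu>.prob_space[of n] by (simp add: int_f)
    finally show ?thesis .
  qed
  have "tight \<mu>"
    unfolding tight_def
  proof (intro conjI allI impI rd)
    fix \<epsilon> :: real assume "\<epsilon> > 0"
    \<comment> \<open>A single small \<open>z\<close> has limiting deficit below
      \<open>\<epsilon> / 2\<close>. The tail bound doubles it, so \<open>1 / z\<close> cuts off
      less than \<open>\<epsilon>\<close> for all large \<open>n\<close>.\<close>
    have "((\<lambda>z. \<psi> z / \<psi> 0) \<longlongrightarrow> \<psi> 0 / \<psi> 0) (at_right 0)"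
      using pos' by (intro tendsto_intros cont) auto
    then have "\<forall>\<^sub>F z in at_right 0. 1 - \<epsilon> / 2 < \<psi> z / \<psi> 0"
      using pos' \<open>\<epsilon> > 0\<close> by (intro order_tendstoD) auto
    then have "\<forall>\<^sub>F z in at_right 0. 0 < z \<and> 1 - \<epsilon> / 2 < \<psi> z / \<psi> 0"
      by (intro eventually_conj eventually_at_right_less)
    from eventually_happens'[OF _ this] obtain z where z: "z > 0" "1 - \<epsilon> / 2 < \<psi> z / \<psi> 0"
      by (auto simp: trivial_limit_at_right_real)
    have "\<forall>\<^sub>F n in sequentially. 1 - \<epsilon> / 2 < L n z"
      using limL[of z] z by (intro order_tendstoD) auto
    then obtain N where N: "\<And>n. n \<ge> N \<Longrightarrow> 1 - \<epsilon> / 2 < L n z"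
      by (auto simp: eventually_sequentially)
    \<comment> \<open>The finitely many remaining indices get their own cut-offs, and
      \<open>b\<close> is the maximum of all of them.\<close>
    have "\<exists>c. 1 - \<epsilon> < cdf (\<mu> n) c" for n
    proof -
      have "\<forall>\<^sub>F c in at_top. 1 - \<epsilon> < cdf (\<mu> n) c"
        using \<mu>.cdf_lim_at_top_prob[of n] \<open>\<epsilon> > 0\<close> by (intro order_tendstoD) auto
      then show ?thesis by (auto simp: eventually_at_top_linorder)
    qed
    then obtain c where c: "\<And>n. 1 - \<epsilon> < cdf (\<mu> n) (c n)" by metis
    define b where "b = Max (insert (1 / z) (c ` {..<N}))"
    have b: "1 / z \<le> b" "\<And>n. n < N \<Longrightarrow> c n \<le> b" by (auto simp: b_def)
    have "1 - \<epsilon> < measure (\<mu> n) {-1<..b}" for n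
    proof -
      have "1 - \<epsilon> < cdf (\<mu> n) b"
      proof (cases "n < N")
        case True
        then show ?thesis using c[of n] \<mu>.cdf_nondecreasing[OF b(2), of n n] by linarith
      next
        case False
        from N[OF leI[OF False]] have "2 * (1 - L n z) < \<epsilon>" by simp
        with False show ?thesis using tail[OF z(1), of n] \<mu>.cdf_nondecreasing[OF b(1), of n] by linarith
      qed
      \<comment> \<open>The interval is open on the left, so its left endpoint has to be negative
        for it to contain a possible atom at \<open>0\<close>.\<close>
      also have "cdf (\<mu> n) b = measure (\<mu> n) {-1<..b}"
        unfolding cdf_def using AE_\<mu>[of n] by (intro \<mu>.finite_measure_eq_AE) auto
      finally show ?thesis .
    qed
    moreover have "- 1 < b" using b(1) z(1) by (smt (verit) divide_pos_pos)
    ultimately show "\<exists>a b. a < b \<and> (\<forall>n. 1 - \<epsilon> < measure (\<mu> n) {a<..b})" by blast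
  qed
  from tight_imp_convergent_subsubsequence[OF this strict_mono_id] obtain r M where
    r: "strict_mono r" and "real_distribution M" and wc: "weak_conv_m (\<mu> \<circ> id \<circ> r) M" by blast
  interpret M: real_distribution M by fact
  have conv: "(\<lambda>n. \<integral>x. g x \<partial>\<mu> (r n)) \<longlonglongrightarrow> (\<integral>x. g x \<partial>M)"
    if "\<And>x. isCont g x" "\<And>x. \<bar>g x\<bar> \<le> 1" for g :: "real \<Rightarrow> real"
    using weak_conv_imp_integral_bdd_continuous_conv[OF _ _ wc, of g 1] that rd M.real_distribution_axioms
    by simp
  have int_M: "(\<integral>x. f z x \<partial>M) = \<psi> z / \<psi> 0" if "z \<ge> 0" for z
  proof (rule LIMSEQ_unique)
    show "(\<lambda>n. \<integral>x. f z x \<partial>\<mu> (r n)) \<longlonglongrightarrow> (\<integral>x. f z x \<partial>M)"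
      using f_bound[OF that] by (intro conv) (auto simp: f_def [abs_def] intro!: continuous_intros)
    show "(\<lambda>n. \<integral>x. f z x \<partial>\<mu> (r n)) \<longlonglongrightarrow> \<psi> z / \<psi> 0"
      using LIMSEQ_subseq_LIMSEQ[OF limL[OF that] r] that by (simp add: int_f o_def)
  qed
  have AE_M: "AE x in M. 0 \<le> x"
  proof -
    \<comment> \<open>\<open>g\<close> is bounded, continuous and zero exactly on the closed
      half-line, so the vanishing of its integrals survives the weak limit.\<close>
    define g where "g x = min 1 (max 0 (- x))" for x :: real
    have [measurable]: "g \<in> borel_measurable borel" unfolding g_def by measurable
    have "(\<lambda>n. \<integral>x. g x \<partial>\<mu> (r n)) \<longlonglongrightarrow> (\<integral>x. g x \<partial>M)"
      by (intro conv) (auto simp: g_def [abs_def] intro!: continuous_intros)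
    moreover have "(\<integral>x. g x \<partial>\<mu> n) = 0" for n
      by (rule integral_eq_zero_AE, use AE_\<mu>[of n] in eventually_elim) (simp add: g_def)
    ultimately have "(\<integral>x. g x \<partial>M) = 0"
      by (simp add: LIMSEQ_const_iff)
    moreover have "integrable M g"
      by (rule M.integrable_const_bound[where B = 1]) (auto simp: g_def)
    ultimately have "AE x in M. g x = 0"
      by (subst (asm) integral_nonneg_eq_0_iff_AE) (auto simp: g_def)
    then show ?thesis by eventually_elim (auto simp: g_def min_def max_def split: if_splits)
  qed
  have "laplace_transform_of M (\<lambda>z. \<psi> z / \<psi> 0)"
    unfolding laplace_transform_of_def
  proof (intro conjI allI impI AE_M)
    fix z :: real assume z: "z \<ge> 0"
    have "(\<integral>\<^sup>+x. ennreal (exp (- (x * z))) \<partial>M) = (\<integral>\<^sup>+x. ennreal (f z x) \<partial>M)"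
      by (rule nn_integral_cong_AE, use AE_M in eventually_elim) (simp add: f_def)
    also have "\<dots> = ennreal (\<psi> z / \<psi> 0)"
      using f_bound[OF z] integrable_f[OF z M.real_distribution_axioms] int_M[OF z]
      by (subst nn_integral_eq_integral) auto
    finally show "(\<integral>\<^sup>+x. ennreal (exp (- (x * z))) \<partial>M) = ennreal (\<psi> z / \<psi> 0)" .
  qed simp
  then have "laplace_transform_of (density M (\<lambda>_. ennreal (\<psi> 0))) (\<lambda>z. \<psi> 0 * (\<psi> z / \<psi> 0))"
    using pos' by (intro laplace_transform_of_scale) auto
  then show ?thesis using pos' by auto
qed

section \<open>An integral representation of the hyperbolic cosine\<close>

lemma nn_integral_logistic:
  fixes r s :: real
  assumes r: "0 < r" "r < 1"
  shows "(\<integral>\<^sup>+y. ennreal (exp (r * y) / (1 + exp (y - s))) \<partial>lborel) = ennreal (Beta r (1 - r) * exp (r * s))"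
proof -
  let ?I = "\<integral>\<^sup>+y. ennreal (exp (r * y) / (1 + exp y)) \<partial>lborel"
  have B: "Beta r (1 - r) > 0" using r by (simp add: Beta_def)
  \<comment> \<open>The Pareto density with shapes \<open>r\<close>, \<open>1 - r\<close> and
    exponent \<open>1\<close> has mass one; in logarithmic coordinates this is the Beta integral.
    The shift by \<open>s\<close> is a translation.\<close>
  have "1 = (\<integral>\<^sup>+y. ennreal (1 / Beta (1 - r) r * (exp (r * y) / (1 + exp y))) \<partial>lborel)"
    using nn_integral_pareto_density[of "\<lambda>_. 1" r "1 - r" 1]
      nn_integral_pareto_density_1[of r "1 - r" 1] r by (simp add: add_pos_pos)
  also have "\<dots> = ennreal (1 / Beta r (1 - r)) * ?I"
    using B by (subst nn_integral_cmult[symmetric]) (auto simp: ennreal_mult[symmetric] Beta_commute)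
  finally have "ennreal (Beta r (1 - r)) = ennreal (Beta r (1 - r)) * (ennreal (1 / Beta r (1 - r)) * ?I)"
    by simp
  also have "\<dots> = ?I"
    using B by (simp add: mult.assoc[symmetric] ennreal_mult[symmetric])
  finally have I: "?I = ennreal (Beta r (1 - r))" by simp
  have "(\<integral>\<^sup>+y. ennreal (exp (r * y) / (1 + exp (y - s))) \<partial>lborel) =
      ennreal \<bar>1\<bar> * (\<integral>\<^sup>+y. ennreal (exp (r * (s + 1 * y)) / (1 + exp (s + 1 * y - s))) \<partial>lborel)"
    by (rule nn_integral_real_affine) auto
  also have "\<dots> = (\<integral>\<^sup>+y. ennreal (exp (r * s)) * ennreal (exp (r * y) / (1 + exp y)) \<partial>lborel)"
    by (simp add: ennreal_mult[symmetric] distrib_left exp_add)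
  also have "\<dots> = ennreal (exp (r * s)) * ?I"
    by (rule nn_integral_cmult) simp
  finally show ?thesis using I B by (simp add: ennreal_mult[symmetric] mult.commute)
qed

lemma nn_integral_lborel_reflect:
  fixes f :: "real \<Rightarrow> ennreal"
  assumes "f \<in> borel_measurable borel"
  shows "(\<integral>\<^sup>+x. f (- x) \<partial>lborel) = (\<integral>\<^sup>+x. f x \<partial>lborel)"
  using nn_integral_real_affine[OF assms, of "-1" 0] by simp

lemma borel_measurable_sinh [measurable]: "(sinh :: real \<Rightarrow> real) \<in> borel_measurable borel"
  by (intro borel_measurable_continuous_onI continuous_intros)

lemma borel_measurable_cosh [measurable]: "(cosh :: real \<Rightarrow> real) \<in> borel_measurable borel"
  by (intro borel_measurable_continuous_onI continuous_intros)

text \<open>The part of the integrand for \<open>cosh (r * s)\<close> that depends on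
  \<open>w = 2 * cosh s\<close>. For fixed \<open>y\<close> and \<open>r > 0\<close> it is a
  nonnegative multiple of \<open>1 / (w + 2 * cosh y)\<close>, hence a Laplace transform in
  \<open>w\<close>.\<close>

definition cosh_kernel :: "real \<Rightarrow> real \<Rightarrow> real \<Rightarrow> real" where
  "cosh_kernel r w y = 2 * sinh y * sinh (r * y) / (w + 2 * cosh y)"

lemma cosh_kernel_nonneg: "r > 0 \<Longrightarrow> w \<ge> 0 \<Longrightarrow> cosh_kernel r w y \<ge> 0"
  by (cases "y \<ge> 0") (auto simp: cosh_kernel_def mult_nonpos_nonpos mult_nonneg_nonpos
      intro!: divide_nonneg_pos add_nonneg_pos)

lemma continuous_on_cosh_kernel [continuous_intros]: "w \<ge> 0 \<Longrightarrow> continuous_on A (cosh_kernel r w)"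
  unfolding cosh_kernel_def [abs_def]
  by (intro continuous_intros ballI less_imp_neq[THEN not_sym] add_nonneg_pos) auto

lemma cosh_kernel_measurable [measurable]: "cosh_kernel r w \<in> borel_measurable borel"
  unfolding cosh_kernel_def [abs_def] by measurable

text \<open>
  Each summand on the right has a Beta integral; averaging over the signs of \<open>s\<close> and \<open>y\<close> is what
  makes the sum a function of \<open>cosh s\<close>.
\<close>

lemma cosh_kernel_identity:
  "cosh (r * y) - cosh_kernel r (2 * cosh s) y =
    (exp (r * y) / (1 + exp (y - s)) + exp (r * y) / (1 + exp (y - - s)) +
     exp (r * - y) / (1 + exp (- y - s)) + exp (r * - y) / (1 + exp (- y - - s))) / 2"
proof -
  \<comment> \<open>In these exponentials the claim is a rational identity in three positive
    variables.\<close>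
  define p q v where "p = exp y" "q = exp (r * y)" "v = exp s"
  have pos: "p > 0" "q > 0" "v > 0" by (simp_all add: p_q_v_def)
  \<comment> \<open>The factors of this denominator are, up to monomials, the denominators of the
    four logistic terms.\<close>
  have D: "v + 1 / v + (p + 1 / p) = (v + p) * (1 + p * v) / (p * v)"
    using pos by (simp add: field_simps)
  have id: "(q + 1 / q) / 2 - (p - 1 / p) * ((q - 1 / q) / 2) / (v + 1 / v + (p + 1 / p)) =
     (q / (1 + p / v) + q / (1 + p * v) + (1 / q) / (1 + 1 / (p * v)) + (1 / q) / (1 + v / p)) / 2"
  proof -
    have nz: "v + p \<noteq> 0" "1 + p * v \<noteq> 0" "p \<noteq> 0" "q \<noteq> 0" "v \<noteq> 0"
      using pos by (auto simp: add_pos_pos less_imp_neq[THEN not_sym])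
    have "q / (1 + p / v) = q * v / (v + p)" "(1 / q) / (1 + 1 / (p * v)) = p * v / (q * (1 + p * v))"
        "(1 / q) / (1 + v / p) = p / (q * (v + p))"
      using pos by (simp_all add: field_simps)
    then show ?thesis
      unfolding D using nz by (simp add: divide_simps) algebra
  qed
  have hyp: "cosh (r * y) = (q + 1 / q) / 2" "sinh (r * y) = (q - 1 / q) / 2"
      "2 * cosh y = p + 1 / p" "2 * sinh y = p - 1 / p" "2 * cosh s = v + 1 / v"
    by (simp_all add: p_q_v_def cosh_def sinh_def exp_minus inverse_eq_divide)
  have exps: "exp (y - s) = p / v" "exp (y - - s) = p * v" "exp (- y - s) = 1 / (p * v)"
      "exp (- y - - s) = v / p" "exp (r * - y) = 1 / q" "exp (r * y) = q"
    by (simp_all add: p_q_v_def exp_minus exp_diff exp_add inverse_eq_divide)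
  show ?thesis
    unfolding cosh_kernel_def hyp exps by (rule id)
qed

text \<open>After reflection in \<open>y\<close>, two of the four logistic terms integrate to
  \<open>Beta r (1 - r) * exp (r * s)\<close> and two to the same with \<open>- s\<close>. Only the
  difference is integrable, as \<open>cosh (r * y)\<close> is not; its nonnegativity serves later to
  control truncated integrals.\<close>

lemma cosh_integral:
  fixes r s :: real
  assumes r: "0 < r" "r < 1"
  shows "integrable lborel (\<lambda>y. cosh (r * y) - cosh_kernel r (2 * cosh s) y)" (is "integrable _ ?q")
    and "(\<integral>y. cosh (r * y) - cosh_kernel r (2 * cosh s) y \<partial>lborel) = 2 * Beta r (1 - r) * cosh (r * s)"
    and "0 \<le> cosh (r * y) - cosh_kernel r (2 * cosh s) y"
proof -
  have B: "Beta r (1 - r) > 0" using r by (simp add: Beta_def)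
  let ?T = "\<lambda>s y. exp (r * y) / (1 + exp (y - s))"
  have T: "?T s y \<ge> 0" for s y by (simp add: add_nonneg_nonneg)
  have nn: "?q y \<ge> 0" for y
    unfolding cosh_kernel_identity using T[of y s] T[of y "-s"] T[of "-y" s] T[of "-y" "-s"] by simp
  then show "0 \<le> cosh (r * y) - cosh_kernel r (2 * cosh s) y" .
  have half: "ennreal ((a + b + c + d) / 2) = ennreal (1 / 2) * (ennreal a + ennreal b + ennreal c + ennreal d)"
    if "a \<ge> 0" "b \<ge> 0" "c \<ge> 0" "d \<ge> 0" for a b c d
  proof -
    have "ennreal (1 / 2 * (a + b + c + d)) = ennreal (1 / 2) * (ennreal a + ennreal b + ennreal c + ennreal d)"
      using that by (subst ennreal_mult) simp_all
    then show ?thesis by simp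
  qed
  have "(\<integral>\<^sup>+y. ennreal (?q y) \<partial>lborel) = (\<integral>\<^sup>+y. ennreal (1 / 2) * (ennreal (?T s y) + ennreal (?T (- s) y) +
      ennreal (?T s (- y)) + ennreal (?T (- s) (- y))) \<partial>lborel)"
    unfolding cosh_kernel_identity by (intro nn_integral_cong half T)
  also have "\<dots> = ennreal (1 / 2) * ((\<integral>\<^sup>+y. ennreal (?T s y) \<partial>lborel) + (\<integral>\<^sup>+y. ennreal (?T (- s) y) \<partial>lborel) +
      (\<integral>\<^sup>+y. ennreal (?T s (- y)) \<partial>lborel) + (\<integral>\<^sup>+y. ennreal (?T (- s) (- y)) \<partial>lborel))"
    by (subst nn_integral_cmult, simp, subst nn_integral_add, simp, simp, subst nn_integral_add, simp, simp,
        subst nn_integral_add, simp, simp, simp)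
  also have "\<dots> = ennreal (1 / 2) * (ennreal (Beta r (1 - r) * exp (r * s)) + ennreal (Beta r (1 - r) * exp (r * - s)) +
      ennreal (Beta r (1 - r) * exp (r * s)) + ennreal (Beta r (1 - r) * exp (r * - s)))"
    using nn_integral_lborel_reflect[of "\<lambda>y. ennreal (?T s y)"] nn_integral_lborel_reflect[of "\<lambda>y. ennreal (?T (- s) y)"]
      nn_integral_logistic[OF r, of s] nn_integral_logistic[OF r, of "- s"]
    by simp
  also have "\<dots> = ennreal (2 * Beta r (1 - r) * cosh (r * s))"
    using B by (subst half[symmetric]) (simp_all add: cosh_def algebra_simps add_divide_distrib del: ennreal_plus)
  finally have "(\<integral>\<^sup>+y. ennreal (?q y) \<partial>lborel) = ennreal (2 * Beta r (1 - r) * cosh (r * s))" .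
  then have "integrable lborel ?q \<and> integral\<^sup>L lborel ?q = 2 * Beta r (1 - r) * cosh (r * s)"
    using nn B by (subst (asm) nn_integral_eq_integrable) (auto simp: cosh_real_nonneg)
  then show "integrable lborel ?q" "(\<integral>y. cosh (r * y) - cosh_kernel r (2 * cosh s) y \<partial>lborel) = 2 * Beta r (1 - r) * cosh (r * s)"
    by auto
qed

section \<open>Representing measures for powers\<close>

text \<open>Writing \<open>1 / (2 + z + 2 * cosh y)\<close> as the integral of
  \<open>exp (- (l * (2 + z + 2 * cosh y)))\<close> over \<open>l > 0\<close> and exchanging
  integrals gives the density \<open>D\<close>. The kernel grows like
  \<open>sinh (r * \<bar>y\<bar>)\<close>, so a bounded range of \<open>y\<close> keeps the
  transform finite.\<close>

lemma laplace_transform_of_cosh_kernel: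
  fixes r a :: real
  assumes "r > 0"
  shows "\<exists>P. laplace_transform_of P (\<lambda>z. LBINT y:{-a..a}. cosh_kernel r (2 + z) y)"
proof -
  let ?S = "\<lambda>y. 2 * sinh y * sinh (r * y)"
  have S: "?S y \<ge> 0" for y
  proof -
    have "?S y = cosh_kernel r 0 y * (2 * cosh y)" by (simp add: cosh_kernel_def)
    then show ?thesis using cosh_kernel_nonneg[OF assms, of 0 y] by simp
  qed
  define D where "D l = indicator {0<..} l * (\<integral>\<^sup>+y. indicator {-a..a} y * ennreal (?S y * exp (- (l * (2 + 2 * cosh y)))) \<partial>lborel)"
    for l :: real
  have [measurable]: "D \<in> borel_measurable borel"
    unfolding D_def by measurable
  have "laplace_transform_of (density lborel D) (\<lambda>z. LBINT y:{-a..a}. cosh_kernel r (2 + z) y)"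
    unfolding laplace_transform_of_def
  proof (intro conjI allI impI)
    show "AE x in density lborel D. 0 \<le> x"
      by (subst AE_density) (auto simp: D_def indicator_def split: if_splits)
    fix z :: real assume z: "z \<ge> 0"
    have c: "2 + z + 2 * cosh y > 0" for y :: real
      using z cosh_real_pos[of y] by linarith
    have "(\<integral>\<^sup>+l. ennreal (exp (- (l * z))) \<partial>density lborel D) =
        (\<integral>\<^sup>+l. D l * ennreal (exp (- (l * z))) \<partial>lborel)"
      by (rule nn_integral_density) auto
    \<comment> \<open>The factor \<open>l powr (1 - 1)\<close> is \<open>1\<close> for
      \<open>l > 0\<close>; it gives the inner integral the shape of
      \<open>nn_integral_powr_exp\<close> with \<open>k = 1\<close>.\<close>
    also have "\<dots> = (\<integral>\<^sup>+l. \<integral>\<^sup>+y. indicator {-a..a} y * ennreal (?S y) *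
        (ennreal (l powr (1 - 1) * exp (- ((2 + z + 2 * cosh y) * l))) * indicator {0<..} l) \<partial>lborel \<partial>lborel)"
    proof (rule nn_integral_cong)
      fix l :: real
      have "D l * ennreal (exp (- (l * z))) = (\<integral>\<^sup>+y. (indicator {0<..} l * ennreal (exp (- (l * z)))) *
         (indicator {-a..a} y * ennreal (?S y * exp (- (l * (2 + 2 * cosh y))))) \<partial>lborel)"
        by (subst nn_integral_cmult) (simp_all add: D_def ac_simps)
      also have "\<dots> = (\<integral>\<^sup>+y. indicator {-a..a} y * ennreal (?S y) *
        (ennreal (l powr (1 - 1) * exp (- ((2 + z + 2 * cosh y) * l))) * indicator {0<..} l) \<partial>lborel)"
      proof (rule nn_integral_cong)
        fix y :: real
        have "exp (- (l * z)) * (?S y * exp (- (l * (2 + 2 * cosh y)))) =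
            ?S y * exp (- ((2 + z + 2 * cosh y) * l))"
          by (simp add: exp_add[symmetric] algebra_simps)
        then have "ennreal (exp (- (l * z))) * ennreal (?S y * exp (- (l * (2 + 2 * cosh y)))) =
            ennreal (?S y) * ennreal (exp (- ((2 + z + 2 * cosh y) * l)))"
          using S[of y] by (simp only: ennreal_mult[symmetric] exp_ge_zero mult_nonneg_nonneg)
        then show "(indicator {0<..} l * ennreal (exp (- (l * z)))) *
         (indicator {-a..a} y * ennreal (?S y * exp (- (l * (2 + 2 * cosh y))))) =
          indicator {-a..a} y * ennreal (?S y) *
        (ennreal (l powr (1 - 1) * exp (- ((2 + z + 2 * cosh y) * l))) * indicator {0<..} l)"
          by (auto simp: indicator_def)
      qed
      finally show "D l * ennreal (exp (- (l * z))) = (\<integral>\<^sup>+y. indicator {-a..a} y * ennreal (?S y) *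
        (ennreal (l powr (1 - 1) * exp (- ((2 + z + 2 * cosh y) * l))) * indicator {0<..} l) \<partial>lborel)" .
    qed
    also have "\<dots> = (\<integral>\<^sup>+y. \<integral>\<^sup>+l. indicator {-a..a} y * ennreal (?S y) *
        (ennreal (l powr (1 - 1) * exp (- ((2 + z + 2 * cosh y) * l))) * indicator {0<..} l) \<partial>lborel \<partial>lborel)"
      by (rule lborel_pair.Fubini') simp
    also have "\<dots> = (\<integral>\<^sup>+y. indicator {-a..a} y * ennreal (?S y) * ennreal (1 / (2 + z + 2 * cosh y)) \<partial>lborel)"
      using c by (subst nn_integral_cmult, simp, subst nn_integral_powr_exp) (simp_all add: abs_of_pos[OF c])
    also have "\<dots> = (\<integral>\<^sup>+y. ennreal (indicator {-a..a} y *\<^sub>R cosh_kernel r (2 + z) y) \<partial>lborel)"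
      using S c
      by (intro nn_integral_cong)
         (auto simp: indicator_def cosh_kernel_def ennreal_mult[symmetric] less_imp_le)
    also have "\<dots> = ennreal (LBINT y:{-a..a}. cosh_kernel r (2 + z) y)"
      unfolding set_lebesgue_integral_def
    proof (rule nn_integral_eq_integral)
      have "set_integrable lborel {-a..a} (cosh_kernel r (2 + z))"
        using z by (intro borel_integrable_atLeastAtMost' continuous_intros) auto
      then show "integrable lborel (\<lambda>y. indicator {-a..a} y *\<^sub>R cosh_kernel r (2 + z) y)"
        by (simp add: set_integrable_def)
      show "AE y in lborel. 0 \<le> indicator {-a..a} y *\<^sub>R cosh_kernel r (2 + z) y"
        using z assms by (simp add: cosh_kernel_nonneg)
    qed
    finally show "(\<integral>\<^sup>+l. ennreal (exp (- (l * z))) \<partial>density lborel D) = ennreal (LBINT y:{-a..a}. cosh_kernel r (2 + z) y)" .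
  qed simp
  then show ?thesis by blast
qed

text \<open>The representing measure is a rescaled Gamma law of shape \<open>k\<close> and rate
  \<open>c / a\<close>.\<close>

lemma laplace_transform_of_linear_powr:
  assumes "a > 0" "c > 0" "k > 0"
  shows "\<exists>P. laplace_transform_of P (\<lambda>z. (c + a * z) powr (- k))"
proof -
  let ?D = "\<lambda>l. ennreal (l powr (k - 1) * exp (- (c / a * l))) * indicator {0<..} l"
  have "laplace_transform_of (density lborel ?D) (\<lambda>z. Gamma k / (c / a + z) powr k)"
    unfolding laplace_transform_of_def
  proof (intro conjI allI impI)
    show "AE x in density lborel ?D. 0 \<le> x"
      by (subst AE_density) (auto simp: indicator_def split: if_splits)
    fix z :: real assume z: "z \<ge> 0"
    have "(\<integral>\<^sup>+l. ennreal (exp (- (l * z))) \<partial>density lborel ?D) = (\<integral>\<^sup>+l. ?D l * ennreal (exp (- (l * z))) \<partial>lborel)"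
      by (rule nn_integral_density) auto
    also have "\<dots> = (\<integral>\<^sup>+l. ennreal (l powr (k - 1) * exp (- ((c / a + z) * l))) * indicator {0<..} l \<partial>lborel)"
      by (intro nn_integral_cong)
         (auto simp: indicator_def ennreal_mult[symmetric] mult.assoc exp_add[symmetric] algebra_simps)
    also have "\<dots> = ennreal (Gamma k / (c / a + z) powr k)"
      using assms z by (intro nn_integral_powr_exp) (auto intro: add_pos_nonneg)
    finally show "(\<integral>\<^sup>+l. ennreal (exp (- (l * z))) \<partial>density lborel ?D) = ennreal (Gamma k / (c / a + z) powr k)" .
  qed simp
  from laplace_transform_of_scale[OF this, of "a powr (- k) / Gamma k"] have
    "laplace_transform_of (density (density lborel ?D) (\<lambda>_. ennreal (a powr (- k) / Gamma k)))
       (\<lambda>z. a powr (- k) / Gamma k * (Gamma k / (c / a + z) powr k))"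
    using assms by simp
  then have "laplace_transform_of (density (density lborel ?D) (\<lambda>_. ennreal (a powr (- k) / Gamma k))) (\<lambda>z. (c + a * z) powr (- k))"
  proof (rule laplace_transform_of_cong)
    fix z :: real assume z: "z \<ge> 0"
    have "c + a * z = a * (c / a + z)" using assms by (simp add: field_simps)
    then have "(c + a * z) powr (- k) = a powr (- k) * (c / a + z) powr (- k)"
      using assms z by (simp add: powr_mult)
    then show "a powr (- k) / Gamma k * (Gamma k / (c / a + z) powr k) = (c + a * z) powr (- k)"
      using less_imp_neq[OF Gamma_real_pos[OF assms(3)]] by (simp add: powr_minus divide_inverse)
  qed
  then show ?thesis by blast
qed

text \<open>The variable is \<open>z = w - 2\<close>, so \<open>arcosh (1 + z / 2)\<close> is the
  nonnegative \<open>s\<close> with \<open>2 * cosh s = w\<close>. For each \<open>n\<close> the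
  truncated integral is the constant \<open>A n\<close> minus the Laplace transform
  \<open>G n\<close>; the split is made before the limit because \<open>A n\<close>
  diverges.\<close>

lemma laplace_transform_of_cosh_powr:
  assumes r: "0 < r" "r < 1" and a: "a > 0" and c: "c > 0" and k: "k > 0"
  shows "\<exists>P. laplace_transform_of P (\<lambda>z. (c + a * (2 * cosh (r * arcosh (1 + z / 2)))) powr (- k))"
proof -
  define B where "B = Beta r (1 - r)"
  have B: "B > 0" using r by (simp add: Beta_def B_def)
  define A where "A n = (LBINT y:{- real n..real n}. cosh (r * y))" for n
  define G where "G n z = (LBINT y:{- real n..real n}. cosh_kernel r (2 + z) y)" for n z
  have w: "2 * cosh (arcosh (1 + z / 2)) = 2 + z" if "z \<ge> 0" for z :: real
    using that by (simp add: cosh_arcosh_real)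
  have q_nonneg: "0 \<le> cosh (r * y) - cosh_kernel r (2 + z) y" if "z \<ge> 0" for y z
    using cosh_integral(3)[OF r, of y "arcosh (1 + z / 2)"] w[OF that] by simp
  have G_nonneg: "G n z \<ge> 0" if "z \<ge> 0" for n z
    unfolding G_def set_lebesgue_integral_def using that r
    by (intro integral_nonneg_AE) (simp add: cosh_kernel_nonneg)
  have diff: "A n - G n z = (LBINT y:{- real n..real n}. cosh (r * y) - cosh_kernel r (2 + z) y)"
    if "z \<ge> 0" for n z
    unfolding A_def G_def using that
    by (intro set_integral_diff(2)[symmetric] borel_integrable_atLeastAtMost' continuous_intros) auto
  have diff_nonneg: "A n - G n z \<ge> 0" if "z \<ge> 0" for n z
    unfolding diff[OF that] set_lebesgue_integral_def using q_nonneg[OF that]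
    by (intro integral_nonneg_AE) simp
  have diff_lim: "(\<lambda>n. A n - G n z) \<longlonglongrightarrow> B * (2 * cosh (r * arcosh (1 + z / 2)))" if "z \<ge> 0" for z
  proof -
    let ?q = "\<lambda>y. cosh (r * y) - cosh_kernel r (2 + z) y"
    have q: "integrable lborel ?q" "(\<integral>y. ?q y \<partial>lborel) = B * (2 * cosh (r * arcosh (1 + z / 2)))"
      using cosh_integral(1,2)[OF r, of "arcosh (1 + z / 2)"] w[OF that] by (simp_all add: B_def)
    \<comment> \<open>The integrand is nonnegative and integrable, so it dominates its own
      truncations.\<close>
    have "(\<lambda>n. \<integral>y. indicator {- real n..real n} y *\<^sub>R ?q y \<partial>lborel) \<longlonglongrightarrow> (\<integral>y. ?q y \<partial>lborel)"
    proof (rule integral_dominated_convergence[where w = ?q])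
      show "AE y in lborel. (\<lambda>n. indicator {- real n..real n} y *\<^sub>R ?q y) \<longlonglongrightarrow> ?q y"
      proof (intro AE_I2 tendsto_eventually)
        fix y :: real
        have "\<forall>\<^sub>F n in sequentially. \<bar>y\<bar> \<le> real n"
          using filterlim_real_sequentially by (simp add: filterlim_at_top)
        then show "\<forall>\<^sub>F n in sequentially. indicator {- real n..real n} y *\<^sub>R ?q y = ?q y"
          by eventually_elim (simp add: abs_le_iff)
      qed
      show "AE y in lborel. norm (indicator {- real n..real n} y *\<^sub>R ?q y) \<le> ?q y" for n
        using q_nonneg[OF that] by (simp add: indicator_def)
    qed (use q in auto)
    then show ?thesis by (simp add: diff[OF that] set_lebesgue_integral_def q(2))
  qed
  \<comment> \<open>Dividing by \<open>B\<close> cancels the Beta factor of the limit.\<close>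
  define \<alpha> where "\<alpha> = a / B"
  have \<alpha>: "\<alpha> > 0" using a B by (simp add: \<alpha>_def)
  \<comment> \<open>Pulling out \<open>C n\<close> leaves \<open>1\<close> minus a rescaled Laplace
    transform, the form needed for the binomial series.\<close>
  define C where "C n = c + \<alpha> * A n" for n
  have C: "C n > 0" for n
  proof -
    have "A n \<ge> 0" using diff_nonneg[of 0 n] G_nonneg[of 0 n] by linarith
    then show ?thesis using c \<alpha> by (simp add: C_def add_pos_nonneg)
  qed
  define \<phi> where "\<phi> n z = (c + \<alpha> * (A n - G n z)) powr (- k)" for n z
  have "\<exists>K. laplace_transform_of K (\<phi> n)" for n
  proof -
    obtain P where "laplace_transform_of P (G n)"
      using laplace_transform_of_cosh_kernel[OF r(1), of "real n"] unfolding G_def by blast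
    then have P: "laplace_transform_of (density P (\<lambda>_. ennreal (\<alpha> / C n))) (\<lambda>z. \<alpha> / C n * G n z)"
      using \<alpha> C[of n] by (intro laplace_transform_of_scale) auto
    \<comment> \<open>Strictness comes from \<open>c > 0\<close>: the difference
      \<open>C n - \<alpha> * G n z\<close> is at least \<open>c\<close>.\<close>
    have "0 \<le> \<alpha> / C n * G n z \<and> \<alpha> / C n * G n z < 1" if "z \<ge> 0" for z
    proof
      show "0 \<le> \<alpha> / C n * G n z" using \<alpha> C[of n] G_nonneg[OF that, of n] by simp
      have "C n - \<alpha> * G n z = c + \<alpha> * (A n - G n z)" by (simp add: C_def algebra_simps)
      also have "\<dots> > 0" using c \<alpha> diff_nonneg[OF that, of n] by (intro add_pos_nonneg) auto
      finally show "\<alpha> / C n * G n z < 1" using C[of n] by simp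
    qed
    from laplace_transform_of_one_minus_powr[OF P k this]
    obtain K where "laplace_transform_of K (\<lambda>z. (1 - \<alpha> / C n * G n z) powr (- k))" by blast
    from laplace_transform_of_scale[OF this, of "C n powr (- k)"]
    have "laplace_transform_of (density K (\<lambda>_. ennreal (C n powr (- k)))) (\<lambda>z. C n powr (- k) * (1 - \<alpha> / C n * G n z) powr (- k))"
      by simp
    then have "laplace_transform_of (density K (\<lambda>_. ennreal (C n powr (- k)))) (\<phi> n)"
    proof (rule laplace_transform_of_cong)
      fix z :: real assume "z \<ge> 0"
      have "c + \<alpha> * (A n - G n z) = C n * (1 - \<alpha> / C n * G n z)"
        using C[of n] by (simp add: C_def field_simps)
      then show "C n powr (- k) * (1 - \<alpha> / C n * G n z) powr (- k) = \<phi> n z"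
        using C[of n] by (simp add: \<phi>_def powr_mult)
    qed
    then show ?thesis by blast
  qed
  then obtain K where K: "\<And>n. laplace_transform_of (K n) (\<phi> n)" by metis
  have pos: "c + a * (2 * cosh (r * x)) > 0" for x
    using c a cosh_real_pos[of "r * x"] by (intro add_pos_nonneg) auto
  show ?thesis
  proof (rule laplace_transform_of_limit[OF K])
    show "\<phi> n z > 0" if "z \<ge> 0" for n z
      unfolding \<phi>_def using c \<alpha> diff_nonneg[OF that, of n] by (smt (verit) mult_nonneg_nonneg powr_gt_zero)
    show "(c + a * (2 * cosh (r * arcosh (1 + 0 / 2)))) powr (- k) > 0"
      using pos[of "arcosh (1 + 0 / 2)"] by simp
    show "(\<lambda>n. \<phi> n z) \<longlonglongrightarrow> (c + a * (2 * cosh (r * arcosh (1 + z / 2)))) powr (- k)" if "z \<ge> 0" for z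
    proof -
      have "(\<lambda>n. c + \<alpha> * (A n - G n z)) \<longlonglongrightarrow> c + \<alpha> * (B * (2 * cosh (r * arcosh (1 + z / 2))))"
        by (intro tendsto_intros diff_lim that)
      then have "(\<lambda>n. c + \<alpha> * (A n - G n z)) \<longlonglongrightarrow> c + a * (2 * cosh (r * arcosh (1 + z / 2)))"
        using B by (simp add: \<alpha>_def)
      then show ?thesis unfolding \<phi>_def
        using pos[of "arcosh (1 + z / 2)"] by (intro tendsto_powr tendsto_const) auto
    qed
    \<comment> \<open>Right continuity at \<open>0\<close> prevents mass from escaping to infinity;
      \<open>arcosh\<close> is continuous up to its endpoint \<open>1\<close>.\<close>
    have "continuous_on {0..} (\<lambda>z::real. (c + a * (2 * cosh (r * arcosh (1 + z / 2)))) powr (- k))"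
      using pos by (intro continuous_intros ballI disjI1) (auto simp: less_le)
    then show "((\<lambda>z. (c + a * (2 * cosh (r * arcosh (1 + z / 2)))) powr (- k)) \<longlongrightarrow>
        (c + a * (2 * cosh (r * arcosh (1 + 0 / 2)))) powr (- k)) (at_right 0)"
      unfolding continuous_on_def by (auto dest!: bspec[of _ _ 0] intro: tendsto_within_subset)
  qed
qed

text \<open>At \<open>r = 1\<close> the Beta integral with parameters \<open>r\<close> and
  \<open>1 - r\<close> diverges, but then \<open>2 * cosh (arcosh (1 + z / 2))\<close> is just
  \<open>2 + z\<close> and the base is linear in \<open>z\<close>.\<close>

lemma laplace_transform_of_cosh_powr_le_1:
  assumes r: "0 < r" "r \<le> 1" and a: "a > 0" and c: "c > 0" and k: "k > 0"
  shows "\<exists>P. laplace_transform_of P (\<lambda>z. (c + a * (2 * cosh (r * arcosh (1 + z / 2)))) powr (- k))"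
proof (cases "r = 1")
  case True
  obtain P where "laplace_transform_of P (\<lambda>z. (c + 2 * a + a * z) powr (- k))"
    using laplace_transform_of_linear_powr[of a "c + 2 * a" k] a c k by auto
  then have "laplace_transform_of P (\<lambda>z. (c + a * (2 * cosh (r * arcosh (1 + z / 2)))) powr (- k))"
    by (rule laplace_transform_of_cong) (simp add: True cosh_arcosh_real algebra_simps)
  then show ?thesis by blast
next
  case False
  then show ?thesis using laplace_transform_of_cosh_powr assms by simp
qed

section \<open>Hyperbolic complete monotonicity of the Pareto density\<close>

lemma hcm_function_pareto_density:
  assumes k: "k1 > 0" "k2 > 0" and r: "r \<in> {-1..1} - {0}"
  shows "hcm_function (pareto_density k1 k2 r)"
  unfolding hcm_function_def
proof (intro conjI allI impI)
  have B: "Beta k2 k1 > 0" using k by (simp add: Beta_def)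
  then show "pareto_density k1 k2 r x \<ge> 0" for x by (simp add: pareto_density_def)
  fix u :: real assume u: "u > 0"
  \<comment> \<open>These coefficients come from expanding
    \<open>(1 + (u * v) powr r) * (1 + (u / v) powr r)\<close>: the terms free of \<open>v\<close>
    make \<open>c\<close>, and \<open>a\<close> multiplies
    \<open>v powr r + v powr (- r)\<close>.\<close>
  define c a where "c = 1 + u powr (2 * r)" "a = u powr r"
  \<comment> \<open>The factors free of \<open>v\<close>: the squared normalising constant and the
    numerators, in which the powers of \<open>v\<close> cancel.\<close>
  define E where "E = (\<bar>r\<bar> / Beta k2 k1)\<^sup>2 * u powr (2 * (k1 * r - 1))"
  define \<psi> where "\<psi> z = (c + a * (2 * cosh (\<bar>r\<bar> * arcosh (1 + z / 2)))) powr (- (k1 + k2))" for z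
  have E: "E \<ge> 0" by (simp add: E_def)
  have ca: "c > 0" "a > 0" using u by (auto simp: c_a_def add_pos_pos)
  obtain P where P: "laplace_transform_of P \<psi>"
    using laplace_transform_of_cosh_powr_le_1[of "\<bar>r\<bar>" a c "k1 + k2"] ca k r unfolding \<psi>_def
    by (auto simp: abs_le_iff)
  then have [measurable_cong, simp]: "sets P = sets borel" and AE_P: "AE l in P. 0 \<le> l"
    by (auto simp: laplace_transform_of_def)
  have product: "pareto_density k1 k2 r (u * v) * pareto_density k1 k2 r (u / v) = E * \<psi> (v + inverse v - 2)"
    if v: "v > 0" for v
  proof -
    \<comment> \<open>\<open>arcosh\<close> inverts \<open>cosh\<close> on nonnegative arguments
      only, hence the absolute value of \<open>ln v\<close>; evenness of \<open>cosh\<close> removes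
      it again, together with that of \<open>r\<close>.\<close>
    have "1 + (v + inverse v - 2) / 2 = cosh \<bar>ln v\<bar>"
      using v by (simp add: cosh_ln_real field_simps)
    then have "arcosh (1 + (v + inverse v - 2) / 2) = \<bar>ln v\<bar>"
      by (simp only: arcosh_cosh_real abs_ge_zero)
    then have "2 * cosh (\<bar>r\<bar> * arcosh (1 + (v + inverse v - 2) / 2)) = 2 * cosh (r * ln v)"
      by (simp add: abs_mult[symmetric])
    also have "\<dots> = v powr r + v powr (- r)"
      using v by (simp add: cosh_def powr_def)
    finally have h: "2 * cosh (\<bar>r\<bar> * arcosh (1 + (v + inverse v - 2) / 2)) = v powr r + v powr (- r)" .
    have pw: "(u * v) powr e = u powr e * v powr e" "(u / v) powr e = u powr e / v powr e"
        "v powr (- e) = 1 / v powr e" "u powr (2 * e) = u powr e * u powr e" for e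
      using u v by (simp_all add: powr_mult powr_divide powr_minus_divide flip: powr_add)
    have "v powr r \<noteq> 0" using v by simp
    then have "c + a * (2 * cosh (\<bar>r\<bar> * arcosh (1 + (v + inverse v - 2) / 2))) =
        (1 + (u * v) powr r) * (1 + (u / v) powr r)"
      unfolding h c_a_def pw by (simp add: field_simps)
    then have \<psi>: "\<psi> (v + inverse v - 2) =
        1 / ((1 + (u * v) powr r) powr (k1 + k2) * (1 + (u / v) powr r) powr (k1 + k2))"
      by (simp only: \<psi>_def powr_minus_divide powr_mult)
    have "(u * v) powr (k1 * r - 1) * (u / v) powr (k1 * r - 1) = u powr (2 * (k1 * r - 1))"
      unfolding pw using v by simp
    then show ?thesis
      unfolding \<psi> E_def pareto_density_def using u v
      by (simp add: power2_eq_square divide_inverse mult_ac)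
  qed
  \<comment> \<open>\<^term>\<open>\<psi>\<close> takes \<open>w - 2 \<ge> 0\<close> rather than \<open>w = v + 1/v\<close> as argument; the factor \<open>exp (2 * l)\<close> undoes the shift.\<close>
  let ?R = "restrict_space borel {0::real..}"
  let ?D = "density P (\<lambda>l. ennreal (E * exp (2 * l)))"
  \<comment> \<open>Division by \<open>u\<close> cancels the factor \<open>u\<close> in the exponent
    of the HCM identity. \<open>max 0 l\<close> makes the map land in the half-line everywhere, and
    equals \<open>l\<close> almost everywhere for \<open>P\<close>.\<close>
  let ?K = "distr ?D ?R (\<lambda>l. max 0 l / u)"
  have [measurable]: "(\<lambda>l. max 0 l / u) \<in> measurable ?D ?R"
    using u by (auto simp: measurable_restrict_space2_iff)
  show "\<exists>K. sets K = sets ?R \<and>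
        (\<forall>v>0. ennreal (pareto_density k1 k2 r (u * v) * pareto_density k1 k2 r (u / v)) =
          (\<integral>\<^sup>+ l. ennreal (exp (- l * u * (v + inverse v))) \<partial>K))"
  proof (intro exI[of _ ?K] conjI allI impI)
    fix v :: real assume v: "v > 0"
    have w: "0 \<le> v + inverse v - 2"
    proof -
      have "v + inverse v - 2 = (v - 1)\<^sup>2 / v" using v by (simp add: field_simps power2_eq_square)
      also have "\<dots> \<ge> 0" using v by simp
      finally show ?thesis .
    qed
    have "(\<integral>\<^sup>+ l. ennreal (exp (- l * u * (v + inverse v))) \<partial>?K) =
        (\<integral>\<^sup>+ l. ennreal (exp (- (max 0 l / u) * u * (v + inverse v))) \<partial>?D)"
      by (rule nn_integral_distr) (auto intro!: measurable_restrict_space1)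
    also have "\<dots> = (\<integral>\<^sup>+ l. ennreal (E * exp (2 * l)) * ennreal (exp (- (max 0 l / u) * u * (v + inverse v))) \<partial>P)"
      by (rule nn_integral_density) auto
    also have "\<dots> = (\<integral>\<^sup>+ l. ennreal E * ennreal (exp (- (l * (v + inverse v - 2)))) \<partial>P)"
      using AE_P
    proof (intro nn_integral_cong_AE, eventually_elim)
      fix l :: real assume "0 \<le> l"
      then show "ennreal (E * exp (2 * l)) * ennreal (exp (- (max 0 l / u) * u * (v + inverse v))) =
          ennreal E * ennreal (exp (- (l * (v + inverse v - 2))))"
        using E u by (simp add: ennreal_mult[symmetric] mult.assoc exp_add[symmetric] algebra_simps)
    qed
    also have "\<dots> = ennreal E * ennreal (\<psi> (v + inverse v - 2))"
      using P w by (subst nn_integral_cmult) (auto simp: laplace_transform_of_def)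
    also have "\<dots> = ennreal (pareto_density k1 k2 r (u * v) * pareto_density k1 k2 r (u / v))"
      unfolding product[OF v] using E by (simp add: ennreal_mult \<psi>_def)
    finally show "ennreal (pareto_density k1 k2 r (u * v) * pareto_density k1 k2 r (u / v)) =
        (\<integral>\<^sup>+ l. ennreal (exp (- l * u * (v + inverse v))) \<partial>?K)" ..
  qed simp
qed

theorem mainTheorem5:
  fixes k1 k2 r :: real
    and M :: "'a measure" and X :: "'a \<Rightarrow> real"
  assumes "k1 > 0" and "k2 > 0"
    and "r \<in> {-1..1} - {0}"
    and "prob_space M" and "X \<in> borel_measurable M"
  shows "(distributed M lborel X (pareto_density k1 k2 r) \<longrightarrow> hcm_random_variable M X) \<and>
    (\<forall>(N :: 'b measure) X1 X2.
       prob_space N \<longrightarrow>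
       prob_space.indep_var N borel X1 borel X2 \<longrightarrow>
       distributed N lborel X1 (gamma_density k1) \<longrightarrow>
       distributed N lborel X2 (gamma_density k2) \<longrightarrow>
       (distributed M lborel X (pareto_density k1 k2 r) \<longleftrightarrow>
        distr M borel X = distr N borel (\<lambda>\<omega>. (X1 \<omega> / X2 \<omega>) powr (1 / r))))"
proof (intro conjI impI allI)
  assume "distributed M lborel X (pareto_density k1 k2 r)"
  moreover have "(\<lambda>x. ennreal (pareto_density k1 k2 r x)) =
      (\<lambda>x. ennreal (if x > 0 then pareto_density k1 k2 r x else 0))"
    by (auto simp: pareto_density_def)
  ultimately show "hcm_random_variable M X"
    unfolding hcm_random_variable_def using hcm_function_pareto_density[OF assms(1-3)] by auto
next
  fix N :: "'b measure" and X1 X2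
  assume *: "prob_space N" "prob_space.indep_var N borel X1 borel X2"
    "distributed N lborel X1 (gamma_density k1)" "distributed N lborel X2 (gamma_density k2)"
  \<comment> \<open>Since the quotient has the Pareto law, both sides of the equivalence say that
    \<open>X\<close> has this law.\<close>
  have "distr N borel (\<lambda>\<omega>. (X1 \<omega> / X2 \<omega>) powr (1 / r)) = density lborel (pareto_density k1 k2 r)"
    using assms by (intro distr_gamma_quotient *) auto
  moreover have "distr M borel X = distr M lborel X" by (rule distr_cong) auto
  ultimately show "distributed M lborel X (pareto_density k1 k2 r) \<longleftrightarrow>
        distr M borel X = distr N borel (\<lambda>\<omega>. (X1 \<omega> / X2 \<omega>) powr (1 / r))"
    using assms(5) by (simp add: distributed_def)
qed

end
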